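(* Let $\delta,H,D>0$. Let $(X,d)$ be a $\delta$-hyperbolic metric space and let $\Gamma$ be a group which is not virtually cyclic, acting properly by isometries on $(X,d)$ with $\operatorname{diam}(\Gamma\backslash X)\le D$ and $\operatorname{Ent}(X,d)\le H$. Then every element $\gamma\in\Gamma\setminus\{e\}$ of infinite order satisfies $$\ell(\gamma)>\frac{2(5D+\delta)}{\nu\big(3^5e^{73H(D+4\delta)}\big)+2}.$$
   Context: A metric space is $\delta$-hyperbolic if it is proper, geodesic, and every geodesic triangle is $\delta$-thin: for a geodesic triangle $\Delta=[x,y,z]$ let $T_\Delta$ be the metric tripod with branch lengths $\alpha,\beta,\gamma\ge0$ determined by $d(x,y)=\alpha+\beta$, $d(x,z)=\alpha+\gamma$, $d(y,z)=\beta+\gamma$, and $f_\Delta:\Delta\to T_\Delta$ the map which is an isometry on each side; $\Delta$ is $\delta$-thin if any two points with the same image under $f_\Delta$ are at distance $\le\delta$. An isometric action is proper if for every $R>0$, $x\in X$, the set $\{\gamma: d(x,\gamma x)\le R\}$ is finite; $\operatorname{diam}(\Gamma\backslash X)$ is taken for the quotient distance $\bar d(\Gamma x,\Gamma y)=\inf_\gamma d(x,\gamma y)$. The entropy is $\operatorname{Ent}(X,d)=\liminf_{R\to\infty}\frac1R\ln\#\{\gamma\in\Gamma: d(x,\gamma x)<R\}$ (independent of $x$). The asymptotic displacement of an isometry $\gamma$ is $\ell(\gamma)=\lim_{k\to+\infty}\frac1k d(x,\gamma^kx)$ (independent of $x$). The function $\nu:[1,\infty)\to\mathbf N^*$ is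 the nondecreasing universal function of Breuillard–Green–Tao: for every $K\ge1$ there is $\nu'(K)\in\mathbf N^*$ such that whenever $A,B$ are finite nonempty subsets of a group $G$ with $\#(A\cdot B)\le K(\#A)^{1/2}(\#B)^{1/2}$, there exist a subgroup $G_0\le G$ and a finite normal subgroup $L\trianglelefteq G_0$ such that $A$ is covered by $\nu(K)$ left translates of $G_0$ and $G_0/L$ is nilpotent with a generating set of fewer than $\nu'(K)$ elements. *)

theory Defs
  imports "HOL-Analysis.Analysis" "HOL-Algebra.Algebra"
begin

definition proper_metric :: "'a::metric_space itself \<Rightarrow> bool" where
  "proper_metric _ \<longleftrightarrow> (\<forall>(x::'a) r. compact (cball x r))"

definition geodesic_seg :: "(real \<Rightarrow> 'a::metric_space) \<Rightarrow> 'a \<Rightarrow> 'a \<Rightarrow> bool" where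
  "geodesic_seg c x y \<longleftrightarrow> c 0 = x \<and> c (dist x y) = y \<and>
     (\<forall>s\<in>{0..dist x y}. \<forall>t\<in>{0..dist x y}. dist (c s) (c t) = \<bar>s - t\<bar>)"

definition geodesic_space :: "'a::metric_space itself \<Rightarrow> bool" where
  "geodesic_space _ \<longleftrightarrow> (\<forall>(x::'a) y. \<exists>c. geodesic_seg c x y)"

text \<open>The geodesic triangle with sides c1 = [x,y], c2 = [x,z], c3 = [y,z] is delta-thin:
  points with the same image under the tripod map are at distance at most delta.
  The tripod branch lengths are alpha (at x), beta (at y), gamma (at z).\<close>
definition thin_triangle ::
  "real \<Rightarrow> 'a::metric_space \<Rightarrow> 'a \<Rightarrow> 'a \<Rightarrow> (real \<Rightarrow> 'a) \<Rightarrow> (real \<Rightarrow> 'a) \<Rightarrow> (real \<Rightarrow> 'a) \<Rightarrow> bool" where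
  "thin_triangle \<delta> x y z c1 c2 c3 \<longleftrightarrow>
     (let \<alpha> = (dist x y + dist x z - dist y z) / 2;
          \<beta> = (dist x y + dist y z - dist x z) / 2;
          \<gamma> = (dist x z + dist y z - dist x y) / 2
      in (\<forall>t\<in>{0..\<alpha>}. dist (c1 t) (c2 t) \<le> \<delta>)
       \<and> (\<forall>t\<in>{0..\<beta>}. dist (c1 (dist x y - t)) (c3 t) \<le> \<delta>)
       \<and> (\<forall>t\<in>{0..\<gamma>}. dist (c2 (dist x z - t)) (c3 (dist y z - t)) \<le> \<delta>))"

definition hyperbolic :: "real \<Rightarrow> 'a::metric_space itself \<Rightarrow> bool" where
  "hyperbolic \<delta> T \<longleftrightarrow> proper_metric T \<and> geodesic_space T \<and>
     (\<forall>(x::'a) y z c1 c2 c3. geodesic_seg c1 x y \<longrightarrow> geodesic_seg c2 x z \<longrightarrow>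
        geodesic_seg c3 y z \<longrightarrow> thin_triangle \<delta> x y z c1 c2 c3)"

definition isometric_action :: "('g, 'b) monoid_scheme \<Rightarrow> ('g \<Rightarrow> 'a::metric_space \<Rightarrow> 'a) \<Rightarrow> bool" where
  "isometric_action G \<phi> \<longleftrightarrow>
     (\<forall>g\<in>carrier G. surj (\<phi> g) \<and> (\<forall>x y. dist (\<phi> g x) (\<phi> g y) = dist x y)) \<and>
     (\<forall>x. \<phi> \<one>\<^bsub>G\<^esub> x = x) \<and>
     (\<forall>g\<in>carrier G. \<forall>h\<in>carrier G. \<forall>x. \<phi> (g \<otimes>\<^bsub>G\<^esub> h) x = \<phi> g (\<phi> h x))"

definition proper_action :: "('g, 'b) monoid_scheme \<Rightarrow> ('g \<Rightarrow> 'a::metric_space \<Rightarrow> 'a) \<Rightarrow> bool" where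
  "proper_action G \<phi> \<longleftrightarrow> (\<forall>R>0. \<forall>x. finite {g\<in>carrier G. dist x (\<phi> g x) \<le> R})"

definition quotient_diam :: "('g, 'b) monoid_scheme \<Rightarrow> ('g \<Rightarrow> 'a::metric_space \<Rightarrow> 'a) \<Rightarrow> ereal" where
  "quotient_diam G \<phi> = (SUP x\<in>UNIV. SUP y\<in>UNIV. ereal (INF g\<in>carrier G. dist x (\<phi> g y)))"

definition entropy_at :: "('g, 'b) monoid_scheme \<Rightarrow> ('g \<Rightarrow> 'a::metric_space \<Rightarrow> 'a) \<Rightarrow> 'a \<Rightarrow> ereal" where
  "entropy_at G \<phi> x = Liminf at_top
     (\<lambda>R::real. ereal (ln (real (card {g\<in>carrier G. dist x (\<phi> g x) < R})) / R))"

definition asymp_displacement :: "('g, 'b) monoid_scheme \<Rightarrow> ('g \<Rightarrow> 'a::metric_space \<Rightarrow> 'a) \<Rightarrow> 'g \<Rightarrow> 'a \<Rightarrow> real" where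
  "asymp_displacement G \<phi> \<gamma> x = lim (\<lambda>k::nat. dist x (\<phi> (\<gamma> [^]\<^bsub>G\<^esub> k) x) / real k)"

definition virtually_cyclic :: "('g, 'b) monoid_scheme \<Rightarrow> bool" where
  "virtually_cyclic G \<longleftrightarrow> (\<exists>H. subgroup H G \<and> (\<exists>a\<in>carrier G. H = generate G {a}) \<and>
      finite (rcosets\<^bsub>G\<^esub> H))"

fun lower_central :: "('g, 'b) monoid_scheme \<Rightarrow> nat \<Rightarrow> 'g set" where
  "lower_central G 0 = carrier G"
| "lower_central G (Suc n) = generate G
     {g \<otimes>\<^bsub>G\<^esub> h \<otimes>\<^bsub>G\<^esub> inv\<^bsub>G\<^esub> g \<otimes>\<^bsub>G\<^esub> inv\<^bsub>G\<^esub> h | g h. g \<in> carrier G \<and> h \<in> lower_central G n}"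

definition nilpotent_group :: "('g, 'b) monoid_scheme \<Rightarrow> bool" where
  "nilpotent_group G \<longleftrightarrow> group G \<and> (\<exists>n. lower_central G n = {\<one>\<^bsub>G\<^esub>})"

text \<open>The Breuillard--Green--Tao covering property of nu, for all groups whose elements live in type 'g.\<close>
definition BGT_property :: "(real \<Rightarrow> nat) \<Rightarrow> 'g itself \<Rightarrow> bool" where
  "BGT_property \<nu> _ \<longleftrightarrow> (\<forall>K\<ge>1. \<exists>\<nu>'::nat. \<nu>' \<ge> 1 \<and>
     (\<forall>(G::'g monoid) A B. group G \<longrightarrow> A \<subseteq> carrier G \<longrightarrow> B \<subseteq> carrier G \<longrightarrow>
        finite A \<longrightarrow> finite B \<longrightarrow> A \<noteq> {} \<longrightarrow> B \<noteq> {} \<longrightarrow>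
        real (card (A <#>\<^bsub>G\<^esub> B)) \<le> K * sqrt (real (card A)) * sqrt (real (card B)) \<longrightarrow>
        (\<exists>G0 L. subgroup G0 G \<and> finite L \<and> L \<lhd> (G\<lparr>carrier := G0\<rparr>) \<and>
           (\<exists>T. finite T \<and> T \<subseteq> carrier G \<and> card T \<le> \<nu> K \<and> A \<subseteq> (\<Union>t\<in>T. t <#\<^bsub>G\<^esub> G0)) \<and>
           nilpotent_group ((G\<lparr>carrier := G0\<rparr>) Mod L) \<and>
           (\<exists>S. finite S \<and> card S < \<nu>' \<and> S \<subseteq> carrier ((G\<lparr>carrier := G0\<rparr>) Mod L) \<and>
                generate ((G\<lparr>carrier := G0\<rparr>) Mod L) S = carrier ((G\<lparr>carrier := G0\<rparr>) Mod L)))))"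

definition BGT_function :: "(real \<Rightarrow> nat) \<Rightarrow> 'g itself \<Rightarrow> bool" where
  "BGT_function \<nu> T \<longleftrightarrow> mono_on {1..} \<nu> \<and> (\<forall>K\<ge>1. \<nu> K \<ge> 1) \<and> BGT_property \<nu> T"

end

theory Submission
  imports Defs
begin

text \<open>Thin triangles give the four-point inequality, and with it three facts.
  \<^item> The ball \<open>A\<close> of radius \<open>R = 36(D + 4\<delta>)\<close> in \<open>\<Gamma>\<close>, for the displacement of a base point, satisfies
    \<open>#(A A) \<le> K #A\<close> with \<open>K = 3\<^sup>5 exp(73 H (D + 4\<delta>))\<close>. A product \<open>k = g h\<close> of elements of the ball of
    radius \<open>r\<close> places \<open>g\<close> near the midpoint of \<open>[z, k z]\<close>, so that the number \<open>N(r)\<close> satisfies a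
    convolution inequality, which bounds the supremum of \<open>N(r) exp(-h r)\<close> by \<open>3 N(R)\<close> for
    \<open>h = H + ln 9 / R\<close>.
  \<^item> An element \<open>\<gamma>\<close> of infinite order has positive translation length \<open>\<ell>\<close>, and there is a point \<open>z\<close> with
    \<open>d(z, \<gamma>\<^sup>k z) \<le> k \<ell> + 6D + 22\<delta>\<close> for all \<open>k\<close>.
  \<^item> The group \<open>E\<close> of those \<open>g\<close> with \<open>g \<gamma>\<^sup>p g\<inverse> = \<gamma>\<^bsup>\<plusminus>p\<^esup>\<close> for some \<open>p > 0\<close> contains \<open>\<langle>\<gamma>\<rangle>\<close> with finite index;
    hence \<open>h \<gamma>\<^sup>j h\<inverse> \<in> E\<close> implies \<open>h \<in> E\<close>.

  If \<open>\<ell>\<close> were small, \<open>A\<close> would contain \<open>\<gamma>\<^sup>k \<sigma>\<close> for \<open>0 \<le> k \<le> \<nu>(K)\<close> and every \<open>\<sigma>\<close> in a generating set. As \<open>A\<close> is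
  covered by \<open>\<nu>(K)\<close> left cosets of a finite-by-nilpotent group \<open>G\<^sub>0\<close>, some \<open>\<sigma>\<inverse> \<gamma>\<^sup>j \<sigma>\<close> with \<open>j > 0\<close> lies in
  \<open>G\<^sub>0\<close>; in particular some \<open>\<gamma>\<^sup>i\<close> does. Going up the lower central series with commutators by \<open>\<gamma>\<^sup>i\<close>
  gives \<open>G\<^sub>0 \<subseteq> E\<close>, so that \<open>\<sigma> \<in> E\<close> and \<open>\<Gamma> = E\<close> is virtually cyclic.\<close>

section \<open>Four-point inequality\<close>

lemma hyperbolic_geodesic_exists:
  assumes "hyperbolic \<delta> TYPE('a::metric_space)"
  obtains c where "geodesic_seg c (x::'a) y"
  using assms unfolding hyperbolic_def geodesic_space_def by blast

lemma geodesic_seg_dist: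
  assumes "geodesic_seg c x y" "0 \<le> s" "s \<le> dist x y"
  shows "dist x (c s) = s" "dist (c s) y = dist x y - s"
proof -
  have iso: "\<forall>s\<in>{0..dist x y}. \<forall>t\<in>{0..dist x y}. dist (c s) (c t) = \<bar>s - t\<bar>"
    and ends: "c 0 = x" "c (dist x y) = y"
    using assms(1) unfolding geodesic_seg_def by auto
  show "dist x (c s) = s" using iso[rule_format, of 0 s] ends assms(2,3) by simp
  show "dist (c s) y = dist x y - s"
    using iso[rule_format, of s "dist x y"] ends assms(2,3) by simp
qed

text \<open>The point \<open>c s\<close> lies on the leg of the tripod at \<open>x\<close> or on the
  one at \<open>y\<close>. Passing to the point with the same image on \<open>[x, w]\<close> or
  \<open>[y, w]\<close> costs \<delta>, and from there the distance to \<open>w\<close> is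
  exact.\<close>

lemma hyperbolic_dist_geodesic_point:
  fixes x y w :: "'a::metric_space"
  assumes hyp: "hyperbolic \<delta> TYPE('a)" and c: "geodesic_seg c x y"
    and s: "0 \<le> s" "s \<le> dist x y"
  shows "dist (c s) w \<le> max (dist x w - s) (dist y w - (dist x y - s)) + \<delta>"
proof -
  obtain c2 where c2: "geodesic_seg c2 x w" using hyperbolic_geodesic_exists[OF hyp] .
  obtain c3 where c3: "geodesic_seg c3 y w" using hyperbolic_geodesic_exists[OF hyp] .
  define \<alpha> where "\<alpha> = (dist x y + dist x w - dist y w) / 2"
  define \<beta> where "\<beta> = (dist x y + dist y w - dist x w) / 2"
  have "thin_triangle \<delta> x y w c c2 c3"
    using hyp c c2 c3 unfolding hyperbolic_def by blast
  then have thin1: "\<forall>t\<in>{0..\<alpha>}. dist (c t) (c2 t) \<le> \<delta>"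
    and thin2: "\<forall>t\<in>{0..\<beta>}. dist (c (dist x y - t)) (c3 t) \<le> \<delta>"
    unfolding thin_triangle_def Let_def \<alpha>_def \<beta>_def by auto
  show ?thesis
  proof (cases "s \<le> \<alpha>")
    case True
    have "\<alpha> \<le> dist x w"
      unfolding \<alpha>_def using dist_triangle[of x y w] by (simp add: dist_commute)
    then have "dist (c2 s) w = dist x w - s"
      using geodesic_seg_dist[OF c2] True s by simp
    moreover have "dist (c s) (c2 s) \<le> \<delta>" using thin1 True s by auto
    ultimately show ?thesis using dist_triangle[of "c s" w "c2 s"] by linarith
  next
    case False
    define t where "t = dist x y - s"
    have t: "0 \<le> t" "t \<le> \<beta>" "\<beta> \<le> dist y w"
      using s False dist_triangle[of x y w] dist_triangle[of x w y] dist_triangle[of y w x]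
      unfolding t_def \<alpha>_def \<beta>_def by (simp_all add: dist_commute field_simps)
    then have "dist (c3 t) w = dist y w - t"
      using geodesic_seg_dist[OF c3] by simp
    moreover have "dist (c s) (c3 t) \<le> \<delta>"
      using thin2[rule_format, of t] t by (simp add: t_def)
    ultimately show ?thesis
      using dist_triangle[of "c s" w "c3 t"] unfolding t_def by linarith
  qed
qed

text \<open>The path from \<open>y\<close> to \<open>w\<close> is led through one point of
  \<open>[x, z]\<close>; each half costs \<delta> by
  \<open>hyperbolic_dist_geodesic_point\<close>.\<close>

lemma hyperbolic_four_point:
  fixes x y z w :: "'a::metric_space"
  assumes hyp: "hyperbolic \<delta> TYPE('a)"
  shows "dist x z + dist y w \<le> max (dist x y + dist z w) (dist x w + dist y z) + 2 * \<delta>"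
proof -
  obtain c where c: "geodesic_seg c x z" using hyperbolic_geodesic_exists[OF hyp] .
  \<comment> \<open>This is the Gromov product of \<open>y\<close> and \<open>z\<close> at
    \<open>x\<close>, the parameter at which the two terms of the maximum for \<open>y\<close>
    coincide.\<close>
  define s where "s = (dist x y + dist x z - dist y z) / 2"
  have s: "0 \<le> s" "s \<le> dist x z"
    using dist_triangle[of x y z] dist_triangle[of y z x]
    by (simp_all add: s_def dist_commute)
  have "dist (c s) y \<le> max (dist x y - s) (dist z y - (dist x z - s)) + \<delta>"
    by (rule hyperbolic_dist_geodesic_point[OF hyp c s])
  moreover have "dist z y - (dist x z - s) = dist x y - s"
    by (simp add: s_def dist_commute field_simps)
  moreover have "dist (c s) w \<le> max (dist x w - s) (dist z w - (dist x z - s)) + \<delta>"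
    by (rule hyperbolic_dist_geodesic_point[OF hyp c s])
  moreover have "dist y w \<le> dist (c s) y + dist (c s) w"
    using dist_triangle[of y w "c s"] by (simp add: dist_commute)
  moreover have "2 * s = dist x y + dist x z - dist y z" by (simp add: s_def)
  ultimately show ?thesis by (simp add: max_def split: if_splits)
qed

lemma hyperbolic_midpoint:
  fixes x y :: "'a::metric_space"
  assumes hyp: "hyperbolic \<delta> TYPE('a)"
  obtains m where "\<And>w. dist m w \<le> max (dist x w) (dist y w) - dist x y / 2 + \<delta>"
proof -
  obtain c where c: "geodesic_seg c x y" using hyperbolic_geodesic_exists[OF hyp] .
  have "dist (c (dist x y / 2)) w \<le> max (dist x w) (dist y w) - dist x y / 2 + \<delta>" for w
    using hyperbolic_dist_geodesic_point[OF hyp c, of "dist x y / 2" w] by (auto simp: max_def)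
  then show ?thesis using that by blast
qed

section \<open>Subadditive sequences\<close>

text \<open>Fekete's lemma. The limit is the infimum of \<open>a n / n\<close> over positive
  \<open>n\<close>, which is why it also bounds every term from below.\<close>

lemma subadditive_converges:
  fixes a :: "nat \<Rightarrow> real"
  assumes sub: "\<And>m n. a (m + n) \<le> a m + a n" and nonneg: "\<And>n. 0 \<le> a n"
  obtains L where "(\<lambda>n. a n / real n) \<longlonglongrightarrow> L" "0 \<le> L" "\<And>n. real n * L \<le> a n"
proof -
  define L where "L = (INF n\<in>{1..}. a n / real n)"
  have bdd: "bdd_below ((\<lambda>n. a n / real n) ` {1..})"
    by (rule bdd_belowI[of _ 0]) (auto simp: nonneg)
  have L_le: "L \<le> a n / real n" if "n \<ge> 1" for n
    unfolding L_def using bdd that by (intro cINF_lower) auto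
  have L0: "0 \<le> L"
    unfolding L_def by (rule cINF_greatest) (auto simp: nonneg)
  have mult: "a (q * m) \<le> real q * a m" if "q \<ge> 1" for q m
    using that
  proof (induction q rule: dec_induct)
    case (step q)
    then show ?case using sub[of m "q * m"] by (simp add: algebra_simps)
  qed simp
  \<comment> \<open>Division of \<open>n\<close> by \<open>m\<close> with remainder: the remainder
    contributes at most the sum, a constant independent of \<open>n\<close>.\<close>
  have upper: "a n \<le> real n * (a m / real m) + (\<Sum>i\<le>m. a i) + a m" if "m \<ge> 1" for n m
  proof -
    have r: "a (n mod m) \<le> (\<Sum>i\<le>m. a i)"
      by (rule member_le_sum) (use that nonneg in \<open>auto simp: less_imp_le\<close>)
    have S0: "0 \<le> (\<Sum>i\<le>m. a i)" by (simp add: nonneg sum_nonneg)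
    show ?thesis
    proof (cases "n div m = 0")
      case True
      then have "n mod m = n" using that by (simp add: div_eq_0_iff)
      then show ?thesis using r nonneg[of m] by (simp add: add_increasing add_increasing2)
    next
      case False
      have "a n \<le> a (n div m * m) + a (n mod m)"
        using sub[of "n div m * m" "n mod m"] by simp
      also have "a (n div m * m) \<le> real (n div m) * a m" using mult False by simp
      also have "real (n div m) * a m \<le> real n / real m * a m"
        by (intro mult_right_mono of_nat_div_le_of_nat nonneg)
      finally show ?thesis using r nonneg[of m] by simp
    qed
  qed
  have "(\<lambda>n. a n / real n) \<longlonglongrightarrow> L"
  proof (rule LIMSEQ_I)
    fix e :: real assume e: "0 < e"
    have "\<exists>x\<in>(\<lambda>n. a n / real n) ` {1..}. x < L + e / 2"
      using e unfolding L_def by (intro cInf_lessD) auto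
    then obtain m where m: "m \<ge> 1" "a m / real m < L + e / 2" by auto
    define B where "B = (\<Sum>i\<le>m. a i) + a m"
    obtain N :: nat where N: "real N > 2 * B / e" using reals_Archimedean2 by blast
    have "norm (a n / real n - L) < e" if "n \<ge> max N 1" for n
    proof -
      have n: "real n > 0" using that by simp
      have "real n > 2 * B / e" using N that by (meson less_le_trans of_nat_le_iff max.bounded_iff)
      then have Bn: "B / real n < e / 2" using n e by (simp add: field_simps)
      have "a n \<le> real n * (a m / real m) + B" using upper[OF m(1), of n] by (simp add: B_def)
      then have "a n / real n \<le> a m / real m + B / real n"
        using n by (simp add: field_simps)
      then have "a n / real n < L + e" using Bn m(2) by linarith
      moreover have "L \<le> a n / real n" using L_le that by simp
      ultimately show ?thesis by (simp add: abs_less_iff)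
    qed
    then show "\<exists>no. \<forall>n\<ge>no. norm (a n / real n - L) < e" by blast
  qed
  moreover have "real n * L \<le> a n" for n
    using L_le[of n] nonneg[of n] by (cases "n = 0") (auto simp: field_simps)
  ultimately show ?thesis using L0 that by blast
qed

section \<open>Translation length\<close>

lemma (in group) conj_nat_pow:
  assumes "g \<in> carrier G" "h \<in> carrier G"
  shows "(h \<otimes> g \<otimes> inv h) [^] (n::nat) = h \<otimes> g [^] n \<otimes> inv h"
proof (induction n)
  case (Suc n)
  have "inv h \<otimes> (h \<otimes> (g \<otimes> inv h)) = g \<otimes> inv h"
    using assms by (simp flip: m_assoc)
  then show ?case using Suc assms by (simp add: m_assoc)
qed (use assms in simp)

lemma (in group) nat_pow_diff:
  assumes "g \<in> carrier G" "i \<le> (j::nat)"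
  shows "inv (g [^] i) \<otimes> g [^] j = g [^] (j - i)" "g [^] j \<otimes> inv (g [^] i) = g [^] (j - i)"
proof -
  have "g [^] j = g [^] i \<otimes> g [^] (j - i)" "g [^] j = g [^] (j - i) \<otimes> g [^] i"
    using assms by (simp_all add: nat_pow_mult)
  then show "inv (g [^] i) \<otimes> g [^] j = g [^] (j - i)" "g [^] j \<otimes> inv (g [^] i) = g [^] (j - i)"
    using assms by (metis inv_solve_left nat_pow_closed, metis inv_solve_right nat_pow_closed)
qed

section \<open>Isometric actions and the displacements of powers\<close>

locale isometric_group_action = group G for G :: "'g monoid" (structure) +
  fixes \<phi> :: "'g \<Rightarrow> 'a::metric_space \<Rightarrow> 'a"
  assumes action: "isometric_action G \<phi>"
begin

lemma act_dist [simp]: "g \<in> carrier G \<Longrightarrow> dist (\<phi> g x) (\<phi> g y) = dist x y"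
  using action unfolding isometric_action_def by blast

lemma act_one [simp]: "\<phi> \<one> x = x"
  using action unfolding isometric_action_def by blast

lemma act_mult: "g \<in> carrier G \<Longrightarrow> h \<in> carrier G \<Longrightarrow> \<phi> (g \<otimes> h) x = \<phi> g (\<phi> h x)"
  using action unfolding isometric_action_def by blast

lemma act_inv [simp]:
  assumes "g \<in> carrier G"
  shows "\<phi> (inv g) (\<phi> g x) = x" "\<phi> g (\<phi> (inv g) x) = x"
  using assms by (simp_all flip: act_mult)

lemma act_dist_inv:
  assumes "g \<in> carrier G"
  shows "dist (\<phi> (inv g) x) y = dist x (\<phi> g y)"
  using act_dist[OF assms, of "\<phi> (inv g) x" y] assms by simp

lemma dist_act_inv:
  assumes "g \<in> carrier G"
  shows "dist y (\<phi> (inv g) x) = dist (\<phi> g y) x"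
  using act_dist_inv[OF assms] by (simp add: dist_commute)

definition disp :: "'g \<Rightarrow> nat \<Rightarrow> 'a \<Rightarrow> real" where
  "disp g k x = dist x (\<phi> (g [^] k) x)"

lemma disp_nonneg [simp]: "0 \<le> disp g k x"
  by (simp add: disp_def)

lemma disp_0 [simp]: "disp g 0 x = 0"
  by (simp add: disp_def)

lemma dist_pow_pow:
  assumes "g \<in> carrier G" "i \<le> j"
  shows "dist (\<phi> (g [^] i) x) (\<phi> (g [^] j) x) = disp g (j - i) x"
    "dist (\<phi> (g [^] j) x) (\<phi> (g [^] i) x) = disp g (j - i) x"
proof -
  have "g [^] j = g [^] i \<otimes> g [^] (j - i)" using assms by (simp add: nat_pow_mult)
  then have "\<phi> (g [^] j) x = \<phi> (g [^] i) (\<phi> (g [^] (j - i)) x)"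
    using assms by (simp add: act_mult)
  then show "dist (\<phi> (g [^] i) x) (\<phi> (g [^] j) x) = disp g (j - i) x"
    "dist (\<phi> (g [^] j) x) (\<phi> (g [^] i) x) = disp g (j - i) x"
    using assms by (simp_all add: disp_def dist_commute)
qed

lemma disp_add_le:
  assumes "g \<in> carrier G"
  shows "disp g (m + n) x \<le> disp g m x + disp g n x"
  using dist_triangle[of x "\<phi> (g [^] (m + n)) x" "\<phi> (g [^] m) x"]
    dist_pow_pow(1)[OF assms, of m "m + n" x] by (simp add: disp_def)

lemma disp_move_le:
  assumes "g \<in> carrier G"
  shows "disp g k x \<le> disp g k y + 2 * dist x y"
proof -
  have "dist x (\<phi> (g [^] k) x) \<le> dist x y + dist y (\<phi> (g [^] k) y)
      + dist (\<phi> (g [^] k) y) (\<phi> (g [^] k) x)"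
    using dist_triangle[of x "\<phi> (g [^] k) x" y] dist_triangle[of y "\<phi> (g [^] k) x" "\<phi> (g [^] k) y"]
    by linarith
  then show ?thesis using assms by (simp add: disp_def dist_commute)
qed

lemma disp_conj:
  assumes "g \<in> carrier G" "h \<in> carrier G"
  shows "disp (h \<otimes> g \<otimes> inv h) k (\<phi> h x) = disp g k x"
  using assms by (simp add: disp_def conj_nat_pow act_mult)

lemma disp_inv:
  assumes "g \<in> carrier G"
  shows "disp (inv g) k x = disp g k x"
  using assms by (simp add: disp_def dist_act_inv dist_commute nat_pow_inv)

text \<open>The value does not depend on the base point, so that an arbitrary one can be used.\<close>
definition translation_length :: "'g \<Rightarrow> real" where
  "translation_length g = asymp_displacement G \<phi> g undefined"

lemma disp_limit_exists:
  assumes "g \<in> carrier G"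
  obtains L where "(\<lambda>k. disp g k x / real k) \<longlonglongrightarrow> L" "0 \<le> L" "\<And>k. real k * L \<le> disp g k x"
  by (rule subadditive_converges[of "\<lambda>k. disp g k x"]) (use assms disp_add_le in auto)

text \<open>Changing the base point alters all displacements by at most a constant, which vanishes
  after division by \<open>k\<close>.\<close>

lemma disp_over_tendsto:
  assumes "g \<in> carrier G"
  shows "(\<lambda>k. disp g k x / real k) \<longlonglongrightarrow> translation_length g"
proof -
  obtain L where L: "(\<lambda>k. disp g k x / real k) \<longlonglongrightarrow> L" using disp_limit_exists[OF assms] by blast
  obtain M where M: "(\<lambda>k. disp g k undefined / real k) \<longlonglongrightarrow> M"
    using disp_limit_exists[OF assms] by blast
  have "M = translation_length g"
    using limI[OF M] unfolding translation_length_def asymp_displacement_def disp_def by simp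
  have "(\<lambda>k. disp g k x / real k - disp g k undefined / real k) \<longlonglongrightarrow> 0"
  proof (rule Lim_null_comparison)
    have "\<bar>disp g k x - disp g k undefined\<bar> \<le> 2 * dist x undefined" for k
      using disp_move_le[OF assms, of k x undefined] disp_move_le[OF assms, of k undefined x]
      by (simp add: dist_commute abs_le_iff)
    then show "\<forall>\<^sub>F k in sequentially.
        norm (disp g k x / real k - disp g k undefined / real k) \<le> 2 * dist x undefined / real k"
      by (intro always_eventually) (simp add: divide_right_mono flip: diff_divide_distrib)
    show "(\<lambda>k. 2 * dist x (undefined::'a) / real k) \<longlonglongrightarrow> 0" by (rule lim_const_over_n)
  qed
  moreover have "(\<lambda>k. disp g k x / real k - disp g k undefined / real k) \<longlonglongrightarrow> L - M"
    by (intro tendsto_diff L M)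
  ultimately have "L = M" using LIMSEQ_unique by fastforce
  then show ?thesis using L \<open>M = translation_length g\<close> by simp
qed

lemma asymp_displacement_eq:
  assumes "g \<in> carrier G"
  shows "asymp_displacement G \<phi> g x = translation_length g"
  using limI[OF disp_over_tendsto[OF assms, of x]]
  unfolding asymp_displacement_def disp_def by simp

lemma translation_length_le_disp:
  assumes "g \<in> carrier G"
  shows "real k * translation_length g \<le> disp g k x"
  using disp_limit_exists[OF assms, of x] LIMSEQ_unique[OF disp_over_tendsto[OF assms, of x]] by metis

lemma translation_length_nonneg:
  assumes "g \<in> carrier G"
  shows "0 \<le> translation_length g"
  using disp_limit_exists[OF assms] LIMSEQ_unique[OF disp_over_tendsto[OF assms]] by metis

lemma translation_length_pow:
  assumes g: "g \<in> carrier G"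
  shows "translation_length (g [^] (m::nat)) = real m * translation_length g"
proof (cases "m = 0")
  case True
  then show ?thesis
    using translation_length_le_disp[of \<one> 1] translation_length_nonneg[of \<one>]
    by (simp add: disp_def)
next
  case False
  show ?thesis
  proof (rule LIMSEQ_unique)
    show "(\<lambda>k. disp (g [^] m) k undefined / real k) \<longlonglongrightarrow> translation_length (g [^] m)"
      using g by (intro disp_over_tendsto) simp
    have "strict_mono (\<lambda>k. m * k)" using False by (simp add: strict_mono_def)
    from LIMSEQ_subseq_LIMSEQ[OF disp_over_tendsto[OF g, of undefined] this]
    have "(\<lambda>k. real m * (disp g (m * k) undefined / real (m * k)))
        \<longlonglongrightarrow> real m * translation_length g"
      by (intro tendsto_mult_left) (simp add: o_def)
    then show "(\<lambda>k. disp (g [^] m) k undefined / real k) \<longlonglongrightarrow> real m * translation_length g"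
      using g False by (simp add: disp_def nat_pow_pow)
  qed
qed

lemma translation_length_conj:
  assumes "g \<in> carrier G" "h \<in> carrier G"
  shows "translation_length (h \<otimes> g \<otimes> inv h) = translation_length g"
  using disp_over_tendsto[of "h \<otimes> g \<otimes> inv h" "\<phi> h undefined"] disp_over_tendsto[of g undefined]
    assms by (simp add: disp_conj LIMSEQ_unique)

lemma translation_length_inv:
  assumes "g \<in> carrier G"
  shows "translation_length (inv g) = translation_length g"
  using disp_over_tendsto[of "inv g" undefined] disp_over_tendsto[of g undefined]
    assms by (simp add: disp_inv LIMSEQ_unique)

end

section \<open>Almost axes\<close>

locale cocompact_hyperbolic_action = isometric_group_action G \<phi>
  for G :: "'g monoid" (structure) and \<phi> :: "'g \<Rightarrow> 'a::metric_space \<Rightarrow> 'a" +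
  fixes \<delta> D :: real
  assumes \<delta>_pos: "\<delta> > 0" and D_pos: "D > 0"
    and hyp: "hyperbolic \<delta> TYPE('a)"
    and proper: "proper_action G \<phi>"
    and diam: "quotient_diam G \<phi> \<le> ereal D"
begin

text \<open>The infimum over the orbit is at most \<open>D\<close>; the slack \<delta> yields an
  actual group element and a strict inequality.\<close>

lemma orbit_near: "\<exists>g\<in>carrier G. dist p (\<phi> g y) < D + \<delta>"
proof -
  have "ereal (INF g\<in>carrier G. dist p (\<phi> g y)) \<le> quotient_diam G \<phi>"
    unfolding quotient_diam_def by (meson SUP_upper2 UNIV_I order_refl)
  then have "(INF g\<in>carrier G. dist p (\<phi> g y)) \<le> D"
    using diam by (metis ereal_less_eq(3) order_trans)
  then have "(INF g\<in>carrier G. dist p (\<phi> g y)) < D + \<delta>" using \<delta>_pos by linarith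
  then have "\<exists>r\<in>(\<lambda>g. dist p (\<phi> g y)) ` carrier G. r < D + \<delta>"
    by (intro cInf_lessD) auto
  then show ?thesis by blast
qed

lemma finite_small_displacement: "finite {g \<in> carrier G. dist x (\<phi> g x) \<le> r}"
proof (rule finite_subset)
  show "{g \<in> carrier G. dist x (\<phi> g x) \<le> r} \<subseteq> {g \<in> carrier G. dist x (\<phi> g x) \<le> max r 1}" by auto
  show "finite {g \<in> carrier G. dist x (\<phi> g x) \<le> max r 1}"
    using proper unfolding proper_action_def by simp
qed

lemmas four_point = hyperbolic_four_point[OF hyp]

text \<open>If \<open>e = disp g 2 x - disp g 1 x - 2\<delta>\<close> is positive, the four-point inequality forces the orbit
  of \<open>x\<close> to progress by at least \<open>e\<close> at each step.\<close>
lemma disp_two_le: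
  assumes g: "g \<in> carrier G"
  shows "disp g 2 x \<le> disp g 1 x + translation_length g + 2 * \<delta>"
proof (rule ccontr)
  define e where "e = disp g 2 x - disp g 1 x - 2 * \<delta>"
  assume "\<not> ?thesis"
  then have e: "translation_length g < e" by (simp add: e_def)
  with translation_length_nonneg[OF g] have e0: "0 < e" by simp
  have step: "disp g (Suc n) x + e \<le> disp g (Suc (Suc n)) x" for n
  proof (induction n)
    case 0
    then show ?case using \<delta>_pos by (simp add: e_def numeral_2_eq_2)
  next
    case (Suc n)
    let ?p = "\<lambda>i::nat. \<phi> (g [^] i) x"
    \<comment> \<open>If the first term were the maximum,
      \<open>disp g (n + 2) x + e \<le> disp g (n + 1) x\<close> would follow, against the induction
      hypothesis. The second term gives the next step.\<close>
    have "dist (?p 0) (?p 2) + dist (?p 1) (?p (n + 3))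
        \<le> max (dist (?p 0) (?p 1) + dist (?p 2) (?p (n + 3)))
              (dist (?p 0) (?p (n + 3)) + dist (?p 1) (?p 2)) + 2 * \<delta>"
      by (rule four_point)
    then have "disp g 2 x + disp g (n + 2) x
        \<le> max (disp g 1 x + disp g (n + 1) x) (disp g (n + 3) x + disp g 1 x) + 2 * \<delta>"
      by (simp only: dist_pow_pow[OF g]) (simp add: numeral_eq_Suc)
    then show ?case using Suc e0 by (simp add: e_def numeral_eq_Suc)
  qed
  have lower: "real n * e \<le> disp g (Suc n) x" for n
  proof (induction n)
    case (Suc n)
    then show ?case using step[of n] by (simp add: algebra_simps)
  qed simp
  have "e \<le> translation_length g"
  proof (rule LIMSEQ_le)
    show "(\<lambda>n. disp g n x / real n) \<longlonglongrightarrow> translation_length g" by (rule disp_over_tendsto[OF g])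
    show "(\<lambda>n. e - e / real n) \<longlonglongrightarrow> e"
      using tendsto_diff[OF tendsto_const lim_const_over_n] by fastforce
    \<comment> \<open>\<open>lower\<close> starts at exponent 1 and so gives
      \<open>(n - 1) * e\<close> for exponent \<open>n\<close>; the defect \<open>e / n\<close>
      vanishes in the limit.\<close>
    have "e - e / real n \<le> disp g n x / real n" if "n \<ge> 1" for n
    proof -
      have "e - e / real n = real (n - 1) * e / real n" using that by (simp add: field_simps)
      then show ?thesis using lower[of "n - 1"] that by (simp add: divide_right_mono)
    qed
    then show "\<exists>N. \<forall>n\<ge>N. e - e / real n \<le> disp g n x / real n" by blast
  qed
  with e show False by simp
qed

text \<open>The midpoint of \<open>[y, \<gamma>\<^sup>J y]\<close> is moved by \<open>\<gamma>\<^sup>J\<close> at most \<open>4\<delta>\<close> more than necessary, and by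
  \<open>\<gamma>\<close> a bounded amount. Translating the midpoints back near \<open>y\<close>, properness leaves finitely many
  conjugates of \<open>\<gamma>\<close>, so that one of them serves infinitely many \<open>J\<close>.\<close>
lemma almost_minimal_powers:
  assumes \<gamma>: "\<gamma> \<in> carrier G"
  obtains z where
    "infinite {J. disp \<gamma> J z \<le> real J * translation_length \<gamma> + 2 * D + 6 * \<delta>}"
proof -
  fix y :: 'a
  let ?l = "translation_length \<gamma>"
  have ex: "\<exists>b\<in>carrier G. disp \<gamma> 1 (\<phi> b y) \<le> disp \<gamma> 1 y + 2 * D + 4 * \<delta>
      \<and> disp \<gamma> J (\<phi> b y) \<le> real J * ?l + 2 * D + 6 * \<delta>" if J: "J > 0" for J
  proof -
    let ?g = "\<gamma> [^] J" and ?a = "disp \<gamma> J y"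
    have g: "?g \<in> carrier G" using \<gamma> by simp
    obtain m where m: "\<And>w. dist m w \<le> max (dist y w) (dist (\<phi> ?g y) w) - dist y (\<phi> ?g y) / 2 + \<delta>"
      using hyperbolic_midpoint[OF hyp, of y "\<phi> ?g y"] by blast
    then have m: "\<And>w. dist m w \<le> max (dist y w) (dist (\<phi> ?g y) w) - ?a / 2 + \<delta>"
      by (simp add: disp_def)
    have my: "dist m y \<le> ?a / 2 + \<delta>" "dist m (\<phi> ?g y) \<le> ?a / 2 + \<delta>"
      using m[of y] m[of "\<phi> ?g y"] by (simp_all add: disp_def dist_commute max_def split: if_splits)
    have "dist y (\<phi> \<gamma> m) \<le> disp \<gamma> 1 y + (?a / 2 + \<delta>)"
      using dist_triangle[of y "\<phi> \<gamma> m" "\<phi> \<gamma> y"] my \<gamma> by (simp add: disp_def dist_commute)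
    moreover have "dist (\<phi> ?g y) (\<phi> \<gamma> m) \<le> disp \<gamma> 1 y + (?a / 2 + \<delta>)"
    proof -
      have "\<phi> \<gamma> (\<phi> ?g y) = \<phi> (\<gamma> [^] Suc J) y"
        using \<gamma> by (simp only: nat_pow_Suc2 act_mult nat_pow_closed)
      then have "dist (\<phi> ?g y) (\<phi> \<gamma> (\<phi> ?g y)) = disp \<gamma> 1 y"
        using dist_pow_pow(1)[OF \<gamma>, of J "Suc J" y] by simp
      then show ?thesis
        using dist_triangle[of "\<phi> ?g y" "\<phi> \<gamma> m" "\<phi> \<gamma> (\<phi> ?g y)"] my \<gamma> by (simp add: dist_commute)
    qed
    ultimately have m1: "disp \<gamma> 1 m \<le> disp \<gamma> 1 y + 2 * \<delta>"
      using m[of "\<phi> \<gamma> m"] \<gamma> by (simp add: disp_def)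
    \<comment> \<open>\<open>disp_two_le\<close> for the power \<open>?g\<close>, of translation
      length \<open>J * ?l\<close>, bounds the distance between \<open>?g y\<close> and
      \<open>inv ?g y\<close>.\<close>
    have two: "disp \<gamma> (2 * J) y \<le> ?a + real J * ?l + 2 * \<delta>"
      using disp_two_le[OF g, of y] translation_length_pow[OF \<gamma>, of J] \<gamma>
      by (simp add: disp_def nat_pow_pow mult.commute)
    have Jl: "0 \<le> real J * ?l" using translation_length_nonneg[OF \<gamma>] by simp
    have "dist (\<phi> ?g y) (\<phi> (inv ?g) y) = disp \<gamma> (2 * J) y"
      using g \<gamma> by (simp add: dist_act_inv disp_def dist_commute nat_pow_mult mult_2 flip: act_mult)
    moreover have "dist y (\<phi> (inv ?g) y) = ?a"
      using g by (simp add: dist_act_inv disp_def dist_commute)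
    ultimately have "dist m (\<phi> (inv ?g) y) \<le> real J * ?l + ?a / 2 + 3 * \<delta>"
      using m[of "\<phi> (inv ?g) y"] two Jl \<delta>_pos by linarith
    then have "dist y (\<phi> ?g m) \<le> real J * ?l + ?a / 2 + 3 * \<delta>"
      using g by (simp add: dist_act_inv dist_commute)
    moreover have "dist (\<phi> ?g y) (\<phi> ?g m) \<le> real J * ?l + ?a / 2 + 3 * \<delta>"
      using my Jl \<delta>_pos unfolding act_dist[OF g] by (simp add: dist_commute)
    \<comment> \<open>The midpoint bound subtracts \<open>?a / 2\<close>, so that only the excess
      over \<open>?a / 2\<close> in the two preceding estimates survives.\<close>
    ultimately have mJ: "disp \<gamma> J m \<le> real J * ?l + 4 * \<delta>"
      using m[of "\<phi> ?g m"] by (simp add: disp_def)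
    obtain b where b: "b \<in> carrier G" "dist m (\<phi> b y) < D + \<delta>" using orbit_near by blast
    have "disp \<gamma> k (\<phi> b y) \<le> disp \<gamma> k m + 2 * (D + \<delta>)" for k
      using disp_move_le[OF \<gamma>, of k "\<phi> b y" m] b by (simp add: dist_commute)
    from this[of 1] this[of J] m1 mJ show ?thesis by (intro bexI[OF _ b(1)]) auto
  qed
  define \<beta> where "\<beta> J = (SOME b. b \<in> carrier G \<and> disp \<gamma> 1 (\<phi> b y) \<le> disp \<gamma> 1 y + 2 * D + 4 * \<delta>
      \<and> disp \<gamma> J (\<phi> b y) \<le> real J * ?l + 2 * D + 6 * \<delta>)" for J
  have \<beta>: "\<beta> J \<in> carrier G" "disp \<gamma> 1 (\<phi> (\<beta> J) y) \<le> disp \<gamma> 1 y + 2 * D + 4 * \<delta>"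
    "disp \<gamma> J (\<phi> (\<beta> J) y) \<le> real J * ?l + 2 * D + 6 * \<delta>" if "J > 0" for J
    using someI_ex[OF ex[OF that, unfolded Bex_def]] unfolding \<beta>_def by blast+
  define \<gamma>' where "\<gamma>' J = inv (\<beta> J) \<otimes> \<gamma> \<otimes> \<beta> J" for J
  have disp': "disp (\<gamma>' J) k y = disp \<gamma> k (\<phi> (\<beta> J) y)" if "J > 0" for J k
    using disp_conj[OF \<gamma>, of "inv (\<beta> J)" k "\<phi> (\<beta> J) y"] \<beta>(1)[OF that] by (simp add: \<gamma>'_def)
  have "\<gamma>' ` {0<..} \<subseteq> {g \<in> carrier G. dist y (\<phi> g y) \<le> disp \<gamma> 1 y + 2 * D + 4 * \<delta>}"
  proof safe
    fix J :: nat assume J: "J > 0"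
    show "\<gamma>' J \<in> carrier G" using \<beta>(1)[OF J] \<gamma> by (simp add: \<gamma>'_def)
    with disp'[OF J, of 1] \<beta>(2)[OF J]
    show "dist y (\<phi> (\<gamma>' J) y) \<le> disp \<gamma> 1 y + 2 * D + 4 * \<delta>" by (simp add: disp_def)
  qed
  then have "finite (\<gamma>' ` {0<..})" using finite_small_displacement finite_subset by blast
  then obtain J0 where J0: "J0 > 0" "infinite {J \<in> {0<..}. \<gamma>' J = \<gamma>' J0}"
    using pigeonhole_infinite[of "{0<..}" \<gamma>'] infinite_Ioi by auto
  \<comment> \<open>Equal conjugates have equal displacements at \<open>y\<close>, so the bound at
    \<open>\<phi> (\<beta> J) y\<close> transfers to the fixed point
    \<open>\<phi> (\<beta> J0) y\<close>.\<close>
  have "disp \<gamma> J (\<phi> (\<beta> J0) y) \<le> real J * ?l + 2 * D + 6 * \<delta>" if "J > 0" "\<gamma>' J = \<gamma>' J0" for J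
    using disp'[OF that(1), of J] disp'[OF J0(1), of J] \<beta>(3)[OF that(1)] that by simp
  then have "{J \<in> {0<..}. \<gamma>' J = \<gamma>' J0}
      \<subseteq> {J. disp \<gamma> J (\<phi> (\<beta> J0) y) \<le> real J * ?l + 2 * D + 6 * \<delta>}" by auto
  then show ?thesis using that J0(2) finite_subset by blast
qed

text \<open>With translation length 0, infinitely many powers would move one point by a bounded
  amount, and properness would make two of them equal.\<close>

lemma translation_length_pos:
  assumes \<gamma>: "\<gamma> \<in> carrier G" and inf: "\<forall>n::nat. n > 0 \<longrightarrow> \<gamma> [^] n \<noteq> \<one>"
  shows "0 < translation_length \<gamma>"
proof (rule ccontr)
  assume "\<not> ?thesis"
  then have 0: "translation_length \<gamma> = 0" using translation_length_nonneg[OF \<gamma>] by simp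
  obtain z where z: "infinite {J. disp \<gamma> J z \<le> 2 * D + 6 * \<delta>}" (is "infinite ?I")
    using almost_minimal_powers[OF \<gamma>] 0 by auto
  have "(\<lambda>J. \<gamma> [^] J) ` ?I \<subseteq> {g \<in> carrier G. dist z (\<phi> g z) \<le> 2 * D + 6 * \<delta>}"
    using \<gamma> by (auto simp: disp_def)
  then have "finite ((\<lambda>J. \<gamma> [^] J) ` ?I)" using finite_small_displacement finite_subset by blast
  then have "\<not> inj_on (\<lambda>J::nat. \<gamma> [^] J) ?I" using z finite_imageD by blast
  then obtain i j :: nat where "i < j" "\<gamma> [^] i = \<gamma> [^] j"
    unfolding inj_on_def by (metis linorder_neqE_nat)
  then have "\<gamma> [^] (j - i) = \<one>" using nat_pow_diff(1)[OF \<gamma>, of i j] \<gamma> by simp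
  then show False using inf \<open>i < j\<close> by simp
qed

text \<open>Almost minimality passes from a large exponent \<open>J\<close> to every fixed
  \<open>k\<close>. The four-point inequality is used twice along the orbit of \<open>z\<close>:
  once to control the exponents \<open>J + k\<close> and \<open>J - k\<close>, once to bound the
  exponent \<open>k\<close> through \<open>2 * J\<close>.\<close>

lemma almost_axis:
  assumes \<gamma>: "\<gamma> \<in> carrier G" and pos: "0 < translation_length \<gamma>"
  obtains z where "\<And>k. disp \<gamma> k z \<le> real k * translation_length \<gamma> + 6 * D + 22 * \<delta>"
proof -
  let ?l = "translation_length \<gamma>"
  obtain z where z: "infinite {J. disp \<gamma> J z \<le> real J * ?l + 2 * D + 6 * \<delta>}"
    using almost_minimal_powers[OF \<gamma>] .
  have "disp \<gamma> k z \<le> real k * ?l + 6 * D + 22 * \<delta>" for k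
  proof -
    \<comment> \<open>Beyond \<open>n0\<close> the displacement of the \<open>J\<close>-th power
      exceeds that of the \<open>k\<close>-th, which decides the maximum in
      \<open>A\<close>.\<close>
    obtain n0 :: nat where n0: "real n0 > disp \<gamma> k z / ?l" using reals_Archimedean2 by blast
    obtain J where J: "J > max n0 k" "disp \<gamma> J z \<le> real J * ?l + 2 * D + 6 * \<delta>"
      using z unfolding infinite_nat_iff_unbounded by blast
    let ?p = "\<lambda>i::nat. \<phi> (\<gamma> [^] i) z"
    have "disp \<gamma> k z < real n0 * ?l" using n0 pos by (simp add: field_simps)
    also have "\<dots> \<le> real J * ?l" using J pos by (intro mult_right_mono) auto
    also have "\<dots> \<le> disp \<gamma> J z" by (rule translation_length_le_disp[OF \<gamma>])
    finally have kJ: "disp \<gamma> k z \<le> disp \<gamma> J z" by simp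
    have "dist (?p 0) (?p (J + k)) + dist (?p k) (?p J)
        \<le> max (dist (?p 0) (?p k) + dist (?p (J + k)) (?p J))
              (dist (?p 0) (?p J) + dist (?p k) (?p (J + k))) + 2 * \<delta>"
      by (rule four_point)
    then have A: "disp \<gamma> (J + k) z + disp \<gamma> (J - k) z \<le> 2 * disp \<gamma> J z + 2 * \<delta>"
      using kJ J(1) by (simp add: dist_pow_pow[OF \<gamma>] disp_def[symmetric] del: nat_pow_0)
    have "dist (?p J) (?p (J + k)) + dist (?p 0) (?p (2 * J))
        \<le> max (dist (?p J) (?p 0) + dist (?p (J + k)) (?p (2 * J)))
              (dist (?p J) (?p (2 * J)) + dist (?p 0) (?p (J + k))) + 2 * \<delta>"
      by (rule four_point)
    moreover have "2 * J - (J + k) = J - k" "2 * J - J = J" by auto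
    ultimately have B: "disp \<gamma> k z + disp \<gamma> (2 * J) z
        \<le> disp \<gamma> J z + max (disp \<gamma> (J - k) z) (disp \<gamma> (J + k) z) + 2 * \<delta>"
      using J(1) by (simp add: dist_pow_pow[OF \<gamma>] disp_def[symmetric] dist_commute[of _ z] max_def
            split: if_splits)
    have lower: "real J * ?l + real k * ?l \<le> disp \<gamma> (J + k) z" "real J * ?l - real k * ?l \<le> disp \<gamma> (J - k) z"
      "2 * (real J * ?l) \<le> disp \<gamma> (2 * J) z" "0 \<le> real k * ?l"
      using translation_length_le_disp[OF \<gamma>, of "J + k" z] translation_length_le_disp[OF \<gamma>, of "J - k" z]
        translation_length_le_disp[OF \<gamma>, of "2 * J" z] J(1) pos
      by (auto simp: algebra_simps of_nat_diff)
    \<comment> \<open>With \<open>c = 2 * D + 6 * \<delta>\<close>, \<open>A\<close> leaves both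
      exponents an excess of at most \<open>2 * c + 2 * \<delta>\<close>, and \<open>B\<close> then
      an excess \<open>3 * c + 4 * \<delta>\<close> for \<open>k\<close>.\<close>
    from A B J(2) lower show ?thesis by linarith
  qed
  then show ?thesis using that by blast
qed

end

section \<open>Elements normalizing a power up to inversion\<close>

text \<open>Downward induction on the lower central series of the quotient. If the image of
  \<open>c\<close> lies in one term, the image of its commutator with \<open>a\<close> lies in the
  next, so this commutator is in \<open>E\<close> and \<open>descent\<close> returns
  \<open>c\<close>. At the last term, \<open>c\<close> is in \<open>L\<close>.\<close>

lemma (in group) nilpotent_quotient_descent:
  assumes L: "L \<lhd> G" and nil: "nilpotent_group (G Mod L)"
    and a: "a \<in> carrier G" and LE: "L \<subseteq> E"
    and descent: "\<And>c. c \<in> carrier G \<Longrightarrow> a \<otimes> c \<otimes> inv a \<otimes> inv c \<in> E \<Longrightarrow> c \<in> E"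
  shows "carrier G \<subseteq> E"
proof -
  interpret L: normal L G by (rule L)
  interpret pr: group_hom G "G Mod L" "\<lambda>x. L #> x"
    by (intro group_hom.intro group_hom_axioms.intro is_group L.factorgroup_is_group L.r_coset_hom_Mod)
  obtain n where n: "lower_central (G Mod L) n = {\<one>\<^bsub>G Mod L\<^esub>}"
    using nil unfolding nilpotent_group_def by blast
  have "\<forall>c\<in>carrier G. L #> c \<in> lower_central (G Mod L) k \<longrightarrow> c \<in> E" if "k \<le> n" for k
    using that
  proof (induction k rule: inc_induct)
    case base
    show ?case
    proof (intro ballI impI)
      fix c assume c: "c \<in> carrier G" "L #> c \<in> lower_central (G Mod L) n"
      then have "L #> c = L" using n by (simp add: FactGroup_def)
      then have "c \<in> L" using c(1) rcos_self[OF c(1) L.subgroup_axioms] by simp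
      then show "c \<in> E" using LE by blast
    qed
  next
    case (step k)
    show ?case
    proof (intro ballI impI)
      fix c assume c: "c \<in> carrier G" "L #> c \<in> lower_central (G Mod L) k"
      let ?d = "a \<otimes> c \<otimes> inv a \<otimes> inv c"
      have "L #> ?d = (L #> a) \<otimes>\<^bsub>G Mod L\<^esub> (L #> c) \<otimes>\<^bsub>G Mod L\<^esub> inv\<^bsub>G Mod L\<^esub> (L #> a)
          \<otimes>\<^bsub>G Mod L\<^esub> inv\<^bsub>G Mod L\<^esub> (L #> c)"
        using a c(1) by simp
      moreover have "L #> a \<in> carrier (G Mod L)" using a by simp
      ultimately have "L #> ?d \<in> lower_central (G Mod L) (Suc k)"
        unfolding lower_central.simps using c(2) by (blast intro: generate.incl)
      then show "c \<in> E" using step.IH descent[OF c(1)] a c(1) by simp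
    qed
  qed
  from this[of 0] show ?thesis
    using pr.hom_closed by auto
qed

section \<open>The group of elements conjugating some power of \<open>x\<close> to itself or to its
  inverse\<close>

context group
begin

text \<open>For \<open>x\<close> of infinite order in a hyperbolic group this is the elementary
  closure of \<open>x\<close>, its maximal virtually cyclic overgroup. The exponent \<open>p\<close>
  may vary with \<open>g\<close>.\<close>

definition quasi_normalizer :: "'a \<Rightarrow> 'a set" where
  "quasi_normalizer x = {g \<in> carrier G. \<exists>p::nat. p > 0 \<and>
     (g \<otimes> x [^] p \<otimes> inv g = x [^] p \<or> g \<otimes> x [^] p \<otimes> inv g = inv (x [^] p))}"

lemma quasi_normalizerI:
  assumes "g \<in> carrier G" "p > 0"
    and "g \<otimes> x [^] (p::nat) \<otimes> inv g \<in> {x [^] p, inv (x [^] p)}"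
  shows "g \<in> quasi_normalizer x"
  using assms unfolding quasi_normalizer_def by blast

lemma quasi_normalizer_closed: "g \<in> quasi_normalizer x \<Longrightarrow> g \<in> carrier G"
  unfolding quasi_normalizer_def by blast

text \<open>All multiples of a valid exponent are valid, so two elements can be given a common
  exponent, the product of theirs.\<close>

lemma quasi_normalizerE:
  assumes "x \<in> carrier G" "g \<in> quasi_normalizer x"
  obtains p :: nat where "p > 0"
    "\<And>m. g \<otimes> x [^] (p * m) \<otimes> inv g \<in> {x [^] (p * m), inv (x [^] (p * m))}"
proof -
  obtain p :: nat where p: "p > 0" "g \<in> carrier G"
    "g \<otimes> x [^] p \<otimes> inv g = x [^] p \<or> g \<otimes> x [^] p \<otimes> inv g = inv (x [^] p)"
    using assms(2) unfolding quasi_normalizer_def by blast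
  have "g \<otimes> x [^] (p * m) \<otimes> inv g = (g \<otimes> x [^] p \<otimes> inv g) [^] m" for m
    using assms(1) p(2) by (simp add: conj_nat_pow nat_pow_pow)
  then have "g \<otimes> x [^] (p * m) \<otimes> inv g \<in> {x [^] (p * m), inv (x [^] (p * m))}" for m
    using p(3) assms(1) by (auto simp: nat_pow_pow nat_pow_inv)
  then show ?thesis using that p(1) by blast
qed

lemma conj_inv:
  assumes "x \<in> carrier G" "g \<in> carrier G"
  shows "g \<otimes> inv x \<otimes> inv g = inv (g \<otimes> x \<otimes> inv g)"
  using assms by (simp add: inv_mult_group m_assoc)

lemma quasi_normalizer_mult:
  assumes x: "x \<in> carrier G" and g: "g \<in> quasi_normalizer x" and h: "h \<in> quasi_normalizer x"
  shows "g \<otimes> h \<in> quasi_normalizer x"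
proof -
  note gc = quasi_normalizer_closed[OF g] and hc = quasi_normalizer_closed[OF h]
  obtain p :: nat where p: "p > 0"
    "\<And>m. g \<otimes> x [^] (p * m) \<otimes> inv g \<in> {x [^] (p * m), inv (x [^] (p * m))}"
    using quasi_normalizerE[OF x g] by blast
  obtain q :: nat where q: "q > 0"
    "\<And>m. h \<otimes> x [^] (q * m) \<otimes> inv h \<in> {x [^] (q * m), inv (x [^] (q * m))}"
    using quasi_normalizerE[OF x h] by blast
  let ?y = "x [^] (p * q)"
  have y: "?y \<in> carrier G" using x by simp
  have "g \<otimes> ?y \<otimes> inv g \<in> {?y, inv ?y}" using p(2)[of q] .
  moreover have "h \<otimes> ?y \<otimes> inv h \<in> {?y, inv ?y}" using q(2)[of p] by (simp add: mult.commute)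
  moreover have "g \<otimes> h \<otimes> ?y \<otimes> inv (g \<otimes> h) = g \<otimes> (h \<otimes> ?y \<otimes> inv h) \<otimes> inv g"
    using y gc hc by (simp add: m_assoc inv_mult_group)
  ultimately have "g \<otimes> h \<otimes> ?y \<otimes> inv (g \<otimes> h) \<in> {?y, inv ?y}"
    using conj_inv[OF y gc] y by auto
  then show ?thesis using quasi_normalizerI[of "g \<otimes> h" "p * q"] p(1) q(1) gc hc by simp
qed

lemma quasi_normalizer_inv:
  assumes x: "x \<in> carrier G" and g: "g \<in> quasi_normalizer x"
  shows "inv g \<in> quasi_normalizer x"
proof -
  note gc = quasi_normalizer_closed[OF g]
  obtain p :: nat where p: "p > 0"
    "g \<otimes> x [^] p \<otimes> inv g = x [^] p \<or> g \<otimes> x [^] p \<otimes> inv g = inv (x [^] p)"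
    using g unfolding quasi_normalizer_def by blast
  let ?y = "x [^] p"
  have y: "?y \<in> carrier G" using x by simp
  have conj_back: "inv g \<otimes> (g \<otimes> ?y \<otimes> inv g) \<otimes> inv (inv g) = ?y"
    using y gc by (simp add: m_assoc) (simp flip: m_assoc)
  have "inv g \<otimes> ?y \<otimes> inv (inv g) \<in> {?y, inv ?y}"
    using p(2)
  proof
    assume "g \<otimes> ?y \<otimes> inv g = ?y"
    then show ?thesis using conj_back by simp
  next
    assume "g \<otimes> ?y \<otimes> inv g = inv ?y"
    then have "inv (inv g \<otimes> ?y \<otimes> inv (inv g)) = ?y"
      using conj_back conj_inv[OF y, of "inv g"] gc by simp
    moreover have "inv g \<otimes> ?y \<otimes> inv (inv g) \<in> carrier G" using y gc by simp
    ultimately have "inv g \<otimes> ?y \<otimes> inv (inv g) = inv ?y" using inv_inv by metis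
    then show ?thesis by simp
  qed
  then show ?thesis using quasi_normalizerI[of "inv g" p] p(1) gc by simp
qed

lemma quasi_normalizer_pow:
  assumes "x \<in> carrier G"
  shows "x [^] (n::nat) \<in> quasi_normalizer x"
proof (rule quasi_normalizerI[of _ 1])
  show "x [^] n \<otimes> x [^] (1::nat) \<otimes> inv (x [^] n) \<in> {x [^] (1::nat), inv (x [^] (1::nat))}"
    using assms nat_pow_diff(2)[OF assms, of n "n + 1"] by (simp add: nat_pow_mult)
qed (use assms in auto)

text \<open>Two conjugates of \<open>l\<close> by powers of \<open>x [^] i\<close> must coincide, so
  \<open>l\<close> commutes with a positive power of \<open>x\<close>.\<close>

lemma finite_orbit_quasi_normalizer:
  assumes x: "x \<in> carrier G" and i: "i > 0" and l: "l \<in> carrier G" and fin: "finite L"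
    and orb: "\<And>n::nat. x [^] (i * n) \<otimes> l \<otimes> inv (x [^] (i * n)) \<in> L"
  shows "l \<in> quasi_normalizer x"
proof -
  let ?c = "\<lambda>n::nat. x [^] (i * n) \<otimes> l \<otimes> inv (x [^] (i * n))"
  have "\<not> inj_on ?c UNIV"
    using orb fin finite_imageD[of ?c UNIV] finite_subset[of "range ?c" L] by auto
  then obtain m n where mn: "m < n" "?c m = ?c n"
    unfolding inj_on_def by (metis linorder_neqE_nat)
  let ?u = "x [^] (i * m)" and ?y = "x [^] (i * (n - m))"
  have u: "?u \<in> carrier G" and y: "?y \<in> carrier G" using x by simp_all
  have "x [^] (i * n) = ?u \<otimes> ?y"
    using x mn(1) by (simp add: nat_pow_mult flip: distrib_left)
  then have "?u \<otimes> l \<otimes> inv ?u = ?u \<otimes> (?y \<otimes> l \<otimes> inv ?y) \<otimes> inv ?u"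
    using mn(2) u y l by (simp add: inv_mult_group m_assoc)
  then have "l = ?y \<otimes> l \<otimes> inv ?y"
    using u y l by (metis inv_closed l_cancel m_closed r_cancel)
  then have "l \<otimes> ?y = ?y \<otimes> l" using y l by (metis inv_solve_right m_closed)
  then have "l \<otimes> ?y \<otimes> inv l = ?y" using y l by (metis inv_solve_right m_closed)
  then show ?thesis using quasi_normalizerI[of l "i * (n - m)"] l i mn(1) by simp
qed

end

section \<open>Finite index of the cyclic subgroup, and roots in the quasi-normalizer\<close>

context cocompact_hyperbolic_action
begin

text \<open>If \<open>\<gamma>\<^sup>M\<close> moves \<open>y\<close> almost minimally for a large \<open>M\<close>, then \<open>\<gamma>\<^sup>M y\<close> is close to the
  geodesic from \<open>y\<close> to \<open>\<gamma>\<^bsup>2M\<^esup> y\<close>, which fellow-travels the almost axis through \<open>z\<close>.\<close>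
lemma close_to_almost_axis:
  assumes \<gamma>: "\<gamma> \<in> carrier G" and pos: "0 < translation_length \<gamma>"
    and z: "\<And>k. disp \<gamma> k z \<le> real k * translation_length \<gamma> + C"
    and y: "disp \<gamma> M y \<le> real M * translation_length \<gamma> + C"
    and M: "real M * translation_length \<gamma> > 2 * dist y z + \<bar>C\<bar> + \<delta>"
  obtains m :: nat where
    "dist (\<phi> (\<gamma> [^] M) y) (\<phi> (\<gamma> [^] m) z) \<le> translation_length \<gamma> + 3 * C + 6 * \<delta>"
proof -
  let ?l = "translation_length \<gamma>"
  define w where "w = \<phi> (\<gamma> [^] M) y"
  define q where "q = \<phi> (\<gamma> [^] (2 * M)) z"
  define q' where "q' = \<phi> (\<gamma> [^] (2 * M)) y"
  define e where "e = dist y z"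
  have g: "\<gamma> [^] (n::nat) \<in> carrier G" for n using \<gamma> by simp
  have C0: "0 \<le> C" using z[of 0] by simp
  have qq: "dist q q' = e" unfolding q_def q'_def e_def act_dist[OF g] by (simp add: dist_commute)
  have wy: "dist w y = disp \<gamma> M y" by (simp add: w_def disp_def dist_commute)
  have wq': "dist w q' = disp \<gamma> M y"
    using dist_pow_pow(1)[OF \<gamma>, of M "2 * M" y] by (simp add: w_def q'_def)
  have yq': "dist y q' = disp \<gamma> (2 * M) y" by (simp add: q'_def disp_def)
  have zq: "dist z q = disp \<gamma> (2 * M) z" by (simp add: q_def disp_def)
  have low: "2 * (real M * ?l) \<le> disp \<gamma> (2 * M) y" "2 * (real M * ?l) \<le> disp \<gamma> (2 * M) z"
    using translation_length_le_disp[OF \<gamma>, of "2 * M"] by (simp_all add: algebra_simps)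
  have M': "real M * ?l > 2 * e + C + \<delta>" using M by (simp add: e_def)
  have e0: "0 \<le> e" by (simp add: e_def)
  have zq': "disp \<gamma> (2 * M) y - e \<le> dist z q'"
    using dist_triangle[of y q' z] yq' by (simp add: e_def)
  have wz: "disp \<gamma> M y - e \<le> dist w z" "dist w z \<le> disp \<gamma> M y + e"
    using dist_triangle[of w y z] dist_triangle[of w z y] wy by (simp_all add: e_def dist_commute)
  have wq: "disp \<gamma> M y - e \<le> dist w q"
    using dist_triangle[of w q' q] wq' qq by simp
  \<comment> \<open>Here and in the next use, the size of \<open>M\<close> excludes one of the two
    alternatives.\<close>
  have "dist w z + dist y q' \<le> max (dist w y + dist z q') (dist w q' + dist y z) + 2 * \<delta>"
    by (rule four_point)
  moreover have "dist w z + dist y q' > dist w q' + dist y z + 2 * \<delta>"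
    using wz wq' yq' low M' e0 C0 by (simp add: e_def)
  ultimately have i: "dist w z + dist y q' \<le> dist w y + dist z q' + 2 * \<delta>" by linarith
  have "dist w q + dist z q' \<le> max (dist w z + dist q q') (dist w q' + dist z q) + 2 * \<delta>"
    by (rule four_point)
  moreover have "dist w q + dist z q' > dist w z + dist q q' + 2 * \<delta>"
    using wq zq' wz qq low M' e0 C0 by linarith
  ultimately have ii: "dist w q + dist z q' \<le> dist w q' + dist z q + 2 * \<delta>" by linarith
  \<comment> \<open>\<open>i\<close> and \<open>ii\<close> are added; twice
    \<open>disp \<gamma> M y\<close> exceeds \<open>disp \<gamma> (2 * M) y\<close> by at most
    \<open>2 * C\<close>. Thus \<open>w\<close> is almost between \<open>z\<close> and
    \<open>q\<close>.\<close>
  from i ii have thin: "dist w z + dist w q \<le> dist z q + 2 * C + 4 * \<delta>"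
    using wy wq' yq' y low by linarith
  \<comment> \<open>This orbit point on the almost axis is about as far from \<open>z\<close> as
    \<open>w\<close> is, up to one translation length.\<close>
  define m where "m = nat \<lfloor>dist w z / ?l\<rfloor>"
  have m: "real m * ?l \<le> dist w z" "dist w z < real m * ?l + ?l"
  proof -
    have "real m = of_int \<lfloor>dist w z / ?l\<rfloor>" using pos by (simp add: m_def)
    then have "real m \<le> dist w z / ?l" "dist w z / ?l < real m + 1" by linarith+
    then show "real m * ?l \<le> dist w z" "dist w z < real m * ?l + ?l"
      using pos by (simp_all add: field_simps)
  qed
  have "real m * ?l \<le> real (2 * M) * ?l" using m(1) wz(2) y M' e0 \<delta>_pos by simp
  then have mM: "m \<le> 2 * M" using pos by (simp flip: of_nat_mult)
  let ?v = "\<phi> (\<gamma> [^] m) z"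
  have vq: "dist ?v q = disp \<gamma> (2 * M - m) z"
    using dist_pow_pow(1)[OF \<gamma> mM, of z] by (simp add: q_def)
  have vq_le: "disp \<gamma> (2 * M - m) z \<le> 2 * (real M * ?l) - real m * ?l + C"
    using z[of "2 * M - m"] mM by (simp add: of_nat_diff algebra_simps)
  have zv: "dist z ?v \<le> real m * ?l + C" using z[of m] by (simp add: disp_def)
  have "dist w ?v + dist z q \<le> max (dist w z + dist ?v q) (dist w q + dist z ?v) + 2 * \<delta>"
    by (rule four_point)
  then have "dist w ?v \<le> ?l + 3 * C + 6 * \<delta>"
    using thin vq vq_le zv m zq low pos C0 \<delta>_pos by linarith
  then show ?thesis using that by (simp add: w_def)
qed

text \<open>A suitable large power of \<gamma> moves \<open>g z\<close> exactly as far as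
  \<open>z\<close>, so \<open>close_to_almost_axis\<close> brings \<open>g z\<close> near the orbit
  of \<open>z\<close> under \<gamma>, up to powers of \<gamma>. The remaining factor has
  displacement bounded independently of \<open>g\<close>, and properness makes the set
  \<open>F\<close> finite.\<close>

lemma quasi_normalizer_finite_cover:
  assumes \<gamma>: "\<gamma> \<in> carrier G" and pos: "0 < translation_length \<gamma>"
  obtains F where "finite F" "F \<subseteq> carrier G"
    "\<And>g. g \<in> quasi_normalizer \<gamma> \<Longrightarrow> \<exists>k::int. \<exists>f\<in>F. g = \<gamma> [^] k \<otimes> f"
proof -
  let ?l = "translation_length \<gamma>"
  obtain z where "\<And>k. disp \<gamma> k z \<le> real k * ?l + 6 * D + 22 * \<delta>"
    using almost_axis[OF assms] by blast
  then have z: "\<And>k. disp \<gamma> k z \<le> real k * ?l + (6 * D + 22 * \<delta>)" by (simp add: add.assoc)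
  define C where "C = 6 * D + 22 * \<delta>"
  define F where "F = {g \<in> carrier G. dist z (\<phi> g z) \<le> ?l + 3 * C + 6 * \<delta>}"
  have "\<exists>k::int. \<exists>f\<in>F. g = \<gamma> [^] k \<otimes> f" if g: "g \<in> quasi_normalizer \<gamma>" for g
  proof -
    note gc = quasi_normalizer_closed[OF g]
    obtain p :: nat where p: "p > 0"
      "\<And>m. inv g \<otimes> \<gamma> [^] (p * m) \<otimes> inv (inv g) \<in> {\<gamma> [^] (p * m), inv (\<gamma> [^] (p * m))}"
      using quasi_normalizerE[OF \<gamma> quasi_normalizer_inv[OF \<gamma> g]] by blast
    obtain n :: nat where n: "real n > (2 * dist (\<phi> g z) z + \<bar>C\<bar> + \<delta>) / ?l"
      using reals_Archimedean2 by blast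
    \<comment> \<open>A multiple of \<open>p\<close> makes conjugation by \<open>inv g\<close>
      preserve this power up to inversion; \<open>n\<close> makes it large compared with the
      distance from \<open>g z\<close> to \<open>z\<close>.\<close>
    define M where "M = p * n"
    have gM: "\<gamma> [^] M \<in> carrier G" using \<gamma> by simp
    have "disp \<gamma> M (\<phi> g z) = dist z (\<phi> (inv g \<otimes> \<gamma> [^] M \<otimes> inv (inv g)) z)"
      using gc gM by (simp add: disp_def act_mult dist_act_inv)
    also have "\<dots> = disp \<gamma> M z"
      using p(2)[of n] gM by (auto simp: M_def disp_def dist_act_inv dist_commute)
    finally have y: "disp \<gamma> M (\<phi> g z) \<le> real M * ?l + C" using z[of M] by (simp add: C_def)
    have "(2 * dist (\<phi> g z) z + \<bar>C\<bar> + \<delta>) < real n * ?l" using n pos by (simp add: field_simps)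
    also have "\<dots> \<le> real M * ?l" using p(1) pos
      by (intro mult_right_mono) (auto simp: M_def simp del: of_nat_mult)
    finally obtain m :: nat where m: "dist (\<phi> (\<gamma> [^] M) (\<phi> g z)) (\<phi> (\<gamma> [^] m) z) \<le> ?l + 3 * C + 6 * \<delta>"
      using close_to_almost_axis[OF \<gamma> pos _ y] z unfolding C_def by blast
    define f where "f = inv (\<gamma> [^] m) \<otimes> (\<gamma> [^] M \<otimes> g)"
    have gm: "\<gamma> [^] m \<in> carrier G" using \<gamma> by simp
    have "dist z (\<phi> f z) = dist (\<phi> (\<gamma> [^] M) (\<phi> g z)) (\<phi> (\<gamma> [^] m) z)"
      using gm gM gc by (simp add: f_def act_mult dist_act_inv dist_commute)
    then have "f \<in> F" using m gm gM gc by (simp add: F_def f_def)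
    moreover have "g = \<gamma> [^] (- int M + int m) \<otimes> f"
    proof -
      have "\<gamma> [^] m \<otimes> f = \<gamma> [^] M \<otimes> g"
        using gm gM gc by (simp add: f_def) (simp flip: m_assoc)
      then have "\<gamma> [^] int m \<otimes> f = \<gamma> [^] int M \<otimes> g" by (simp add: int_pow_int)
      moreover have "\<gamma> [^] (- int M + int m) = inv (\<gamma> [^] int M) \<otimes> \<gamma> [^] int m"
        using \<gamma> by (simp only: int_pow_mult int_pow_neg)
      moreover have "f \<in> carrier G" using gm gM gc by (simp add: f_def)
      ultimately show ?thesis using \<gamma> gc
        by (metis int_pow_closed inv_closed inv_solve_left m_assoc m_closed)
    qed
    ultimately show ?thesis by blast
  qed
  moreover have "finite F" unfolding F_def by (rule finite_small_displacement)
  moreover have "F \<subseteq> carrier G" by (auto simp: F_def)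
  ultimately show ?thesis using that by blast
qed

text \<open>The conjugate \<open>h \<gamma>\<^sup>j h\<inverse>\<close> has a power in \<open>\<langle>\<gamma>\<rangle>\<close>, and the translation lengths
  determine the exponent up to sign.\<close>
lemma conj_pow_in_quasi_normalizer:
  assumes \<gamma>: "\<gamma> \<in> carrier G" and pos: "0 < translation_length \<gamma>"
    and h: "h \<in> carrier G" and j: "j > 0"
    and mem: "h \<otimes> \<gamma> [^] (j::nat) \<otimes> inv h \<in> quasi_normalizer \<gamma>"
  shows "h \<in> quasi_normalizer \<gamma>"
proof -
  define b where "b = h \<otimes> \<gamma> [^] j \<otimes> inv h"
  have b: "b \<in> carrier G" using \<gamma> h by (simp add: b_def)
  obtain F where F: "finite F" "F \<subseteq> carrier G"
    "\<And>g. g \<in> quasi_normalizer \<gamma> \<Longrightarrow> \<exists>k::int. \<exists>f\<in>F. g = \<gamma> [^] k \<otimes> f"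
    using quasi_normalizer_finite_cover[OF \<gamma> pos] by blast
  have "b [^] (n::nat) \<in> quasi_normalizer \<gamma>" for n
  proof (induction n)
    case 0
    show ?case using quasi_normalizer_pow[OF \<gamma>, of 0] by simp
  next
    case (Suc n)
    then show ?case using quasi_normalizer_mult[OF \<gamma>] mem by (simp add: b_def)
  qed
  then have "\<forall>n::nat. \<exists>f\<in>F. \<exists>k::int. b [^] n = \<gamma> [^] k \<otimes> f" using F(3) by blast
  then obtain f k where fk: "\<And>n::nat. f n \<in> F" "\<And>n. b [^] n = \<gamma> [^] (k n :: int) \<otimes> f n"
    by metis
  \<comment> \<open>Two powers of \<open>b\<close> share a representative in \<open>F\<close>; it
    cancels in their quotient and leaves a power of \<gamma>.\<close>
  have "\<not> inj_on f UNIV"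
    using fk(1) F(1) finite_imageD[of f UNIV] finite_subset[of "range f" F] by auto
  then obtain m n where mn: "m < n" "f m = f n"
    unfolding inj_on_def by (metis linorder_neqE_nat)
  define q where "q = n - m"
  have q: "q > 0" using mn by (simp add: q_def)
  have fc: "f n \<in> carrier G" using fk(1) F(2) by blast
  have "b [^] q = b [^] n \<otimes> inv (b [^] m)"
    using nat_pow_diff(2)[OF b, of m n] mn by (simp add: q_def)
  also have "\<dots> = \<gamma> [^] k n \<otimes> (f n \<otimes> inv (f n) \<otimes> inv (\<gamma> [^] k m))"
    unfolding fk(2) mn(2) using fc \<gamma> by (simp only: inv_mult_group m_assoc m_closed inv_closed int_pow_closed)
  also have "\<dots> = \<gamma> [^] (k n - k m)"
    using fc \<gamma> by (simp add: int_pow_diff)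
  finally have bq: "b [^] q = \<gamma> [^] (k n - k m)" .
  define t where "t = nat \<bar>k n - k m\<bar>"
  have t: "b [^] q \<in> {\<gamma> [^] t, inv (\<gamma> [^] t)}"
  proof (cases "k n - k m \<ge> 0")
    case True
    then have "k n - k m = int t" by (simp add: t_def)
    then show ?thesis using bq by (simp add: int_pow_int)
  next
    case False
    then have "k n - k m = - int t" by (simp add: t_def)
    then show ?thesis using bq \<gamma> by (simp add: int_pow_neg int_pow_int)
  qed
  have bq': "b [^] q = h \<otimes> \<gamma> [^] (j * q) \<otimes> inv h"
    using \<gamma> h by (simp add: b_def conj_nat_pow nat_pow_pow)
  have "translation_length (b [^] q) = real t * translation_length \<gamma>"
    using t \<gamma> by (auto simp: translation_length_pow translation_length_inv)
  moreover have "translation_length (b [^] q) = real (j * q) * translation_length \<gamma>"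
    using \<gamma> h by (simp add: bq' translation_length_conj translation_length_pow del: of_nat_mult)
  ultimately have "t = j * q" using pos by (metis mult_right_cancel less_irrefl of_nat_eq_iff)
  then show ?thesis using quasi_normalizerI[of h "j * q"] h t bq' j q by simp
qed

lemma virtually_cyclic_if_quasi_normalizer:
  assumes \<gamma>: "\<gamma> \<in> carrier G" and pos: "0 < translation_length \<gamma>"
    and all: "carrier G \<subseteq> quasi_normalizer \<gamma>"
  shows "virtually_cyclic G"
proof -
  obtain F where F: "finite F" "F \<subseteq> carrier G"
    "\<And>g. g \<in> quasi_normalizer \<gamma> \<Longrightarrow> \<exists>k::int. \<exists>f\<in>F. g = \<gamma> [^] k \<otimes> f"
    using quasi_normalizer_finite_cover[OF \<gamma> pos] by blast
  let ?H = "generate G {\<gamma>}"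
  have H: "subgroup ?H G" using \<gamma> by (intro generate_is_subgroup) simp
  have "rcosets ?H \<subseteq> (\<lambda>f. ?H #> f) ` F"
  proof
    fix V assume "V \<in> rcosets ?H"
    then obtain a where a: "a \<in> carrier G" "V = ?H #> a" unfolding RCOSETS_def by blast
    then obtain k :: int and f where kf: "f \<in> F" "a = \<gamma> [^] k \<otimes> f" using F(3) all by blast
    have fc: "f \<in> carrier G" using kf F by blast
    have "\<gamma> [^] k \<in> ?H" using generate_pow[OF \<gamma>] by blast
    then have "?H #> (\<gamma> [^] k) = ?H" using H \<gamma> by (simp add: coset_join2)
    then have "?H #> a = ?H #> f"
      using coset_mult_assoc[of ?H "\<gamma> [^] k" f] kf \<gamma> fc subgroup.subset[OF H] by simp
    then show "V \<in> (\<lambda>f. ?H #> f) ` F" using a kf by blast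
  qed
  then have "finite (rcosets ?H)" using F(1) finite_surj by blast
  then show ?thesis unfolding virtually_cyclic_def using H \<gamma> by blast
qed

end

section \<open>Doubling of orbit balls\<close>

context group
begin

primrec set_pow :: "'a set \<Rightarrow> nat \<Rightarrow> 'a set" where
  "set_pow B 0 = {\<one>}"
| "set_pow B (Suc n) = B <#> set_pow B n"

lemma finite_card_set_mult:
  assumes "finite A" "finite B"
  shows "finite (A <#> B)" "card (A <#> B) \<le> card A * card B"
proof -
  have eq: "A <#> B = (\<lambda>(a, b). a \<otimes> b) ` (A \<times> B)" unfolding set_mult_def by auto
  show "finite (A <#> B)" using assms by (simp add: eq)
  show "card (A <#> B) \<le> card A * card B"
    using card_image_le[of "A \<times> B" "\<lambda>(a, b). a \<otimes> b"] assms by (simp add: eq card_cartesian_product)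
qed

lemma finite_card_set_pow:
  assumes "finite B"
  shows "finite (set_pow B n) \<and> card (set_pow B n) \<le> card B ^ n"
proof (induction n)
  case (Suc n)
  then show ?case
    using finite_card_set_mult[OF assms, of "set_pow B n"] mult_le_mono2[of "card (set_pow B n)"]
    by (simp add: order_trans)
qed simp

lemma set_pow_subset:
  assumes "B \<subseteq> S" "\<one> \<in> S" "\<And>a b. a \<in> S \<Longrightarrow> b \<in> S \<Longrightarrow> a \<otimes> b \<in> S"
  shows "set_pow B n \<subseteq> S"
  by (induction n) (use assms in \<open>auto simp: set_mult_def\<close>)

end

text \<open>With \<open>F\<close> the supremum of \<open>N \<rho> exp (- h \<rho>)\<close>, the hypothesis gives \<open>F\<^sup>2 \<le> F N(R) + 2/3 F\<^sup>2\<close>.\<close>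
lemma exponential_bound_from_splitting:
  fixes N :: "real \<Rightarrow> real"
  assumes h: "h > 0" and \<Delta>: "exp (h * \<Delta>) = 2" and c: "exp (h * (R - 2 * c)) \<ge> 6"
    and nonneg: "\<And>\<rho>. 0 \<le> N \<rho>" and pos: "N 1 > 0" and bdd: "\<And>\<rho>. N \<rho> \<le> C * exp (h * \<rho>)"
    and split: "\<And>\<rho> n. \<rho> \<le> R - c + real n * \<Delta> \<Longrightarrow> N \<rho> ^ 2 \<le> N (2 * \<rho>) * N R
       + (\<Sum>j<n. N (2 * \<rho> - 2 * (R - c + real j * \<Delta>)) * N (R + real (Suc j) * \<Delta>))"
  shows "N \<rho> \<le> 3 * N R * exp (h * \<rho>)"
proof -
  define x where "x = (\<lambda>\<rho>. N \<rho> * exp (- (h * \<rho>)))"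
  define F where "F = (SUP \<rho>. x \<rho>)"
  have xC: "x \<rho> \<le> C" for \<rho>
  proof -
    have "x \<rho> \<le> C * exp (h * \<rho>) * exp (- (h * \<rho>))"
      unfolding x_def by (intro mult_right_mono bdd) simp
    then show ?thesis by (simp add: mult.assoc flip: exp_add)
  qed
  have xF: "x \<rho> \<le> F" for \<rho>
    unfolding F_def using xC by (intro cSUP_upper bdd_aboveI[of _ C]) auto
  have NF: "N \<rho> \<le> F * exp (h * \<rho>)" for \<rho>
    using xF[of \<rho>] unfolding x_def by (simp add: exp_minus field_simps)
  have F0: "F > 0" using xF[of 1] pos unfolding x_def
    by (meson exp_gt_zero less_le_trans mult_pos_pos)
  have \<Delta>0: "\<Delta> > 0"
  proof -
    have "exp (h * \<Delta>) > 1" using \<Delta> by simp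
    then show ?thesis using h by (simp add: zero_less_mult_iff)
  qed
  have x2: "x \<rho> ^ 2 \<le> F * N R + 2 / 3 * F\<^sup>2" for \<rho>
  proof -
    obtain n :: nat where "real n > (\<rho> - (R - c)) / \<Delta>" using reals_Archimedean2 by blast
    then have n: "\<rho> \<le> R - c + real n * \<Delta>" using \<Delta>0 by (simp add: field_simps)
    let ?E = "exp (h * (2 * \<rho>))"
    \<comment> \<open>The exponents add up to those of
      \<open>2 * \<rho> + \<Delta> - (R - 2 * c) - j * \<Delta>\<close>, so the factors are
      \<open>2\<close>, at most \<open>1 / 6\<close> and \<open>2 ^ (- j)\<close>; the geometric
      series then sums to at most \<open>2 / 3\<close>.\<close>
    have summand: "N (2 * \<rho> - 2 * (R - c + real j * \<Delta>)) * N (R + real (Suc j) * \<Delta>)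
        \<le> ?E * F\<^sup>2 * (1 / 3 * (1 / 2) ^ j)" for j
    proof -
      have "N (2 * \<rho> - 2 * (R - c + real j * \<Delta>)) * N (R + real (Suc j) * \<Delta>)
          \<le> (F * exp (h * (2 * \<rho> - 2 * (R - c + real j * \<Delta>)))) * (F * exp (h * (R + real (Suc j) * \<Delta>)))"
        by (intro mult_mono NF nonneg) (use F0 in simp)
      also have "\<dots> = F\<^sup>2 * exp (h * (2 * \<rho> - 2 * (R - c + real j * \<Delta>)) + h * (R + real (Suc j) * \<Delta>))"
        by (simp add: exp_add power2_eq_square)
      also have "h * (2 * \<rho> - 2 * (R - c + real j * \<Delta>)) + h * (R + real (Suc j) * \<Delta>)
          = h * (2 * \<rho>) + h * \<Delta> - h * (R - 2 * c) - real j * (h * \<Delta>)"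
        by (simp add: algebra_simps)
      also have "exp \<dots> = ?E * 2 / exp (h * (R - 2 * c)) / 2 ^ j"
        by (simp add: exp_add exp_diff exp_of_nat_mult \<Delta>)
      also have "F\<^sup>2 * \<dots> \<le> F\<^sup>2 * (?E * 2 / 6 / 2 ^ j)"
        using c by (intro mult_left_mono divide_right_mono divide_left_mono) auto
      also have "\<dots> = ?E * F\<^sup>2 * (1 / 3 * (1 / 2) ^ j)" by (simp add: power_one_over)
      finally show ?thesis .
    qed
    have "(\<Sum>j<n. (1 / 2) ^ j) \<le> (2::real)"
      by (simp add: geometric_sum)
    then have geo: "(\<Sum>j<n. ?E * F\<^sup>2 * (1 / 3 * (1 / 2) ^ j)) \<le> ?E * F\<^sup>2 * (1 / 3 * 2)"
      unfolding sum_distrib_left[symmetric] by (intro mult_left_mono) auto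
    have "(\<Sum>j<n. N (2 * \<rho> - 2 * (R - c + real j * \<Delta>)) * N (R + real (Suc j) * \<Delta>))
        \<le> (\<Sum>j<n. ?E * F\<^sup>2 * (1 / 3 * (1 / 2) ^ j))"
      by (intro sum_mono summand)
    then have "N \<rho> ^ 2 \<le> F * ?E * N R + ?E * F\<^sup>2 * (1 / 3 * 2)"
      using split[OF n] geo mult_right_mono[OF NF[of "2 * \<rho>"] nonneg[of R]]
      by linarith
    then have "N \<rho> ^ 2 \<le> ?E * (F * N R + 2 / 3 * F\<^sup>2)" by (simp add: algebra_simps)
    moreover have "x \<rho> ^ 2 = N \<rho> ^ 2 / ?E"
    proof -
      have "?E = exp (h * \<rho>) ^ 2" unfolding exp_double[symmetric] by (simp add: mult_ac)
      then show ?thesis unfolding x_def by (simp add: exp_minus power_mult_distrib field_simps)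
    qed
    ultimately show ?thesis
      by (simp only: pos_divide_le_eq[OF exp_gt_zero] mult.commute)
  qed
  have "F \<le> sqrt (F * N R + 2 / 3 * F\<^sup>2)"
    by (subst F_def, rule cSUP_least) (simp, rule real_le_rsqrt[OF x2])
  then have "F\<^sup>2 \<le> F * N R + 2 / 3 * F\<^sup>2"
    using F0 by (intro sqrt_ge_absD) simp
  then have "F * F \<le> F * (3 * N R)" by (simp add: power2_eq_square)
  then have "F \<le> 3 * N R" using F0 by simp
  then show ?thesis using NF[of \<rho>] by (meson exp_ge_zero mult_right_mono order_trans)
qed

section \<open>Growth of balls in an orbit\<close>

context cocompact_hyperbolic_action
begin

text \<open>The inequality is strict so that these are the sets counted by
  \<open>entropy_at\<close>.\<close>

definition orbit_ball :: "'a \<Rightarrow> real \<Rightarrow> 'g set" where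
  "orbit_ball z r = {g \<in> carrier G. dist z (\<phi> g z) < r}"

lemma finite_orbit_ball: "finite (orbit_ball z r)"
  by (rule finite_subset[OF _ finite_small_displacement[of z r]]) (auto simp: orbit_ball_def)

lemma orbit_ball_mono: "r \<le> s \<Longrightarrow> orbit_ball z r \<subseteq> orbit_ball z s"
  by (auto simp: orbit_ball_def)

lemma card_orbit_ball_mono: "r \<le> s \<Longrightarrow> card (orbit_ball z r) \<le> card (orbit_ball z s)"
  by (intro card_mono finite_orbit_ball orbit_ball_mono)

lemma orbit_ball_closed: "orbit_ball z r \<subseteq> carrier G"
  by (auto simp: orbit_ball_def)

lemma one_in_orbit_ball: "r > 0 \<Longrightarrow> \<one> \<in> orbit_ball z r"
  by (simp add: orbit_ball_def)

lemma mult_in_orbit_ball: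
  assumes "g \<in> orbit_ball z r" "h \<in> orbit_ball z s"
  shows "g \<otimes> h \<in> orbit_ball z (r + s)"
  using assms dist_triangle[of z "\<phi> g (\<phi> h z)" "\<phi> g z"] by (auto simp: orbit_ball_def act_mult)

text \<open>A geodesic from \<open>p\<close> to \<open>y\<close> is cut into \<open>n\<close> pieces
  shorter than \<open>s\<close> and each division point is replaced by a nearby orbit point. The
  quotients of consecutive group elements telescope to \<open>inv a \<otimes> b\<close>.\<close>

lemma chain_in_set_pow:
  assumes "dist p y < real n * s" and "a \<in> carrier G" "b \<in> carrier G"
    and "dist p (\<phi> a z) < D + \<delta>" "dist y (\<phi> b z) < D + \<delta>"
  shows "inv a \<otimes> b \<in> set_pow (orbit_ball z (s + 2 * (D + \<delta>))) n"
  using assms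
proof (induction n arbitrary: p a)
  case (Suc n)
  have near: "inv a \<otimes> c \<in> orbit_ball z (s + 2 * (D + \<delta>))"
    if "c \<in> carrier G" "dist q (\<phi> c z) < D + \<delta>" "dist p q < s" for c q
  proof -
    have "dist (\<phi> a z) (\<phi> c z) \<le> dist p (\<phi> a z) + dist p q + dist q (\<phi> c z)"
      using dist_triangle[of "\<phi> a z" "\<phi> c z" p] dist_triangle[of p "\<phi> c z" q] by (simp add: dist_commute)
    then show ?thesis
      using that Suc.prems by (simp add: orbit_ball_def act_mult dist_act_inv)
  qed
  show ?case
  proof (cases "n = 0")
    case True
    then have "inv a \<otimes> b \<in> orbit_ball z (s + 2 * (D + \<delta>))" using near[of b y] Suc.prems by simp
    then show ?thesis using True Suc.prems by (force simp: set_mult_def)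
  next
    case False
    obtain c where c: "geodesic_seg c p y" using hyperbolic_geodesic_exists[OF hyp] .
    define t where "t = dist p y / real (Suc n)"
    have t: "0 \<le> t" "t \<le> dist p y" "t < s" "dist p y - t < real n * s"
    proof -
      have eq: "dist p y = t * real (Suc n)" by (simp add: t_def)
      show "0 \<le> t" by (simp add: t_def)
      then show "t \<le> dist p y" unfolding eq by (simp add: algebra_simps)
      show ts: "t < s"
        using Suc.prems(1) unfolding eq by (simp add: mult.commute[of t])
      show "dist p y - t < real n * s"
        unfolding eq using ts False by (simp add: algebra_simps)
    qed
    note ct = geodesic_seg_dist[OF c t(1,2)]
    obtain e where e: "e \<in> carrier G" "dist (c t) (\<phi> e z) < D + \<delta>" using orbit_near by blast
    have "inv a \<otimes> e \<in> orbit_ball z (s + 2 * (D + \<delta>))" using near[OF e] ct t by simp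
    moreover have "inv e \<otimes> b \<in> set_pow (orbit_ball z (s + 2 * (D + \<delta>))) n"
      using Suc.IH[OF _ e(1) Suc.prems(3) e(2) Suc.prems(5)] ct t by simp
    moreover have "inv a \<otimes> b = (inv a \<otimes> e) \<otimes> (inv e \<otimes> b)"
      using e(1) Suc.prems by (metis inv_closed m_assoc m_closed r_inv r_one)
    ultimately show ?thesis by (auto simp: set_mult_def)
  qed
qed simp

lemma orbit_ball_subset_set_pow:
  "orbit_ball z (real n * s) \<subseteq> set_pow (orbit_ball z (s + 2 * (D + \<delta>))) n"
proof
  fix g assume g: "g \<in> orbit_ball z (real n * s)"
  then show "g \<in> set_pow (orbit_ball z (s + 2 * (D + \<delta>))) n"
    using chain_in_set_pow[of z "\<phi> g z" n s \<one> g z] D_pos \<delta>_pos by (simp add: orbit_ball_def)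
qed

text \<open>The lower limit only provides one large radius \<open>r0\<close> with few elements.
  Chains of steps of length \<open>s\<close>, slightly less than \<open>r0\<close>, propagate this
  to all radii, at the price of replacing \<open>H\<close> by a larger \<open>h\<close>.\<close>

lemma orbit_ball_exponential_growth:
  assumes ent: "entropy_at G \<phi> z \<le> ereal H" and H: "H > 0" and h: "h > H"
  obtains C where "\<And>r. real (card (orbit_ball z r)) \<le> C * exp (h * r)"
proof -
  \<comment> \<open>Half of the gap is spent on the lower limit, half on the loss from
    \<open>r0\<close> to \<open>s\<close>; \<open>r0 \<ge> q\<close> makes the second half
    sufficient.\<close>
  define e where "e = (h - H) / 2"
  define q where "q = 2 * (D + \<delta>) * h / e"
  define r1 where "r1 = q + 2 * (D + \<delta>) + 1"
  have e: "e > 0" using h by (simp add: e_def)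
  have "\<exists>r\<ge>r1. ln (real (card (orbit_ball z r))) / r < H + e"
  proof (rule ccontr)
    assume "\<not> ?thesis"
    then have "\<forall>\<^sub>F r in at_top. ereal (H + e)
        \<le> ereal (ln (real (card {g \<in> carrier G. dist z (\<phi> g z) < r})) / r)"
      unfolding eventually_at_top_linorder orbit_ball_def by (auto simp: not_less)
    then have "ereal (H + e) \<le> entropy_at G \<phi> z"
      unfolding entropy_at_def by (rule Liminf_bounded)
    then have "ereal (H + e) \<le> ereal H" using ent by (rule order_trans)
    then show False using e by simp
  qed
  then obtain r0 where r0: "r0 \<ge> r1" "ln (real (card (orbit_ball z r0))) / r0 < H + e" by blast
  have q: "q > 0" using e H h D_pos \<delta>_pos by (simp add: q_def)
  have r0_pos: "r0 > 2 * (D + \<delta>)" "r0 > 0"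
    using r0(1) q D_pos \<delta>_pos unfolding r1_def by simp_all
  define s where "s = r0 - 2 * (D + \<delta>)"
  have s: "s > 0" using r0_pos by (simp add: s_def)
  define N0 where "N0 = real (card (orbit_ball z r0))"
  have N0: "N0 \<ge> 1"
    using one_in_orbit_ball[OF r0_pos(2), of z] finite_orbit_ball[of z r0]
    unfolding N0_def by (metis One_nat_def Suc_leI card_gt_0_iff empty_iff of_nat_1 of_nat_le_iff)
  have "(H + e) * r0 \<le> h * s"
  proof -
    have "q \<le> r0" using r0(1) D_pos \<delta>_pos by (simp add: r1_def distrib_left)
    then have "2 * (D + \<delta>) * h \<le> e * r0" using e by (simp add: q_def field_simps)
    moreover have "h = H + e + e" by (simp add: e_def)
    then have "h * r0 = (H + e) * r0 + e * r0" by (simp add: algebra_simps)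
    ultimately show ?thesis by (simp add: s_def algebra_simps)
  qed
  moreover have "ln N0 < (H + e) * r0" using r0(2) r0_pos by (simp add: N0_def field_simps)
  ultimately have "ln N0 \<le> h * s" by linarith
  then have N0_le: "N0 \<le> exp (h * s)"
    using N0 by (metis exp_le_cancel_iff exp_ln less_le_trans zero_less_one)
  have "real (card (orbit_ball z r)) \<le> N0 * exp (h * r)" for r
  proof (cases "r \<le> 0")
    case True
    then have "orbit_ball z r = {}" 
      using zero_le_dist by (fastforce simp: orbit_ball_def dest: less_le_trans)
    then show ?thesis using N0 by simp
  next
    case False
    define n where "n = nat \<lfloor>r / s\<rfloor>"
    have "real n = of_int \<lfloor>r / s\<rfloor>" using False s by (simp add: n_def)
    then have "real n \<le> r / s" "r / s < real n + 1" by linarith+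
    then have n: "real n * s \<le> r" "r \<le> real (Suc n) * s" using s by (simp_all add: field_simps)
    have "card (orbit_ball z r) \<le> card (orbit_ball z (real (Suc n) * s))"
      by (rule card_orbit_ball_mono[OF n(2)])
    also have "\<dots> \<le> card (set_pow (orbit_ball z r0) (Suc n))"
      using orbit_ball_subset_set_pow[of z "Suc n" s] finite_card_set_pow[OF finite_orbit_ball[of z r0], of "Suc n"]
      by (intro card_mono) (simp_all add: s_def)
    also have "\<dots> \<le> card (orbit_ball z r0) ^ Suc n"
      using finite_card_set_pow[OF finite_orbit_ball] by blast
    finally have "real (card (orbit_ball z r)) \<le> N0 ^ Suc n"
      unfolding N0_def by (metis of_nat_le_iff of_nat_power)
    also have "\<dots> = N0 * N0 ^ n" by simp
    also have "\<dots> \<le> N0 * exp (h * s) ^ n"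
      using N0 N0_le by (intro mult_left_mono power_mono) auto
    also have "exp (h * s) ^ n = exp (h * (real n * s))"
      by (simp add: exp_of_nat_mult[symmetric] mult_ac)
    also have "N0 * \<dots> \<le> N0 * exp (h * r)"
      using n(1) H h N0 by simp
    finally show ?thesis .
  qed
  then show ?thesis using that by blast
qed

text \<open>Since \<open>g z\<close> is at distance less than \<open>r\<close> from both endpoints of \<open>[z, k z]\<close>, it is close to the
  midpoint.\<close>
lemma card_factorizations_le:
  assumes k: "k \<in> carrier G"
  shows "card {g \<in> orbit_ball z r. inv g \<otimes> k \<in> orbit_ball z r}
    \<le> card (orbit_ball z (r - dist z (\<phi> k z) / 2 + (D + 2 * \<delta>)))"
proof -
  obtain m where m: "\<And>w. dist m w \<le> max (dist z w) (dist (\<phi> k z) w) - dist z (\<phi> k z) / 2 + \<delta>"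
    using hyperbolic_midpoint[OF hyp, of z "\<phi> k z"] by blast
  obtain a where a: "a \<in> carrier G" "dist m (\<phi> a z) < D + \<delta>" using orbit_near by blast
  show ?thesis
  \<comment> \<open>Translation by \<open>inv a\<close> carries the orbit points near the midpoint
    to a ball around \<open>z\<close>.\<close>
  proof (rule card_inj_on_le[of "\<lambda>g. inv a \<otimes> g"])
    show "inj_on (\<lambda>g. inv a \<otimes> g) {g \<in> orbit_ball z r. inv g \<otimes> k \<in> orbit_ball z r}"
      using a(1) by (auto simp: inj_on_def orbit_ball_def)
    show "finite (orbit_ball z (r - dist z (\<phi> k z) / 2 + (D + 2 * \<delta>)))" by (rule finite_orbit_ball)
    show "(\<lambda>g. inv a \<otimes> g) ` {g \<in> orbit_ball z r. inv g \<otimes> k \<in> orbit_ball z r}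
        \<subseteq> orbit_ball z (r - dist z (\<phi> k z) / 2 + (D + 2 * \<delta>))"
    proof safe
      fix g assume g: "g \<in> orbit_ball z r" "inv g \<otimes> k \<in> orbit_ball z r"
      then have gc: "g \<in> carrier G" by (simp add: orbit_ball_def)
      have "dist z (\<phi> g z) < r" "dist (\<phi> k z) (\<phi> g z) < r"
        using g gc k by (simp_all add: orbit_ball_def act_mult dist_act_inv dist_commute)
      then have "dist m (\<phi> g z) < r - dist z (\<phi> k z) / 2 + \<delta>" using m[of "\<phi> g z"] by linarith
      then have "dist (\<phi> a z) (\<phi> g z) < r - dist z (\<phi> k z) / 2 + (D + 2 * \<delta>)"
        using dist_triangle[of "\<phi> a z" "\<phi> g z" m] a(2) by (simp add: dist_commute)
      then show "inv a \<otimes> g \<in> orbit_ball z (r - dist z (\<phi> k z) / 2 + (D + 2 * \<delta>))"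
        using a gc by (simp add: orbit_ball_def act_mult dist_act_inv)
    qed
  qed
qed

text \<open>Pairs of elements of the ball of radius \<open>r\<close> are sorted by their product \<open>k\<close>, and the products
  by \<open>r - d(z, k z) / 2\<close>.\<close>
lemma card_orbit_ball_splitting:
  fixes z :: 'a and R \<Delta> r :: real and n :: nat
  defines "c \<equiv> D + 2 * \<delta>" and "N \<equiv> \<lambda>r. real (card (orbit_ball z r))"
  assumes r: "r \<le> R - c + real n * \<Delta>"
  shows "N r ^ 2 \<le> N (2 * r) * N R
    + (\<Sum>j<n. N (2 * r - 2 * (R - c + real j * \<Delta>)) * N (R + real (Suc j) * \<Delta>))"
proof -
  let ?B = "orbit_ball z r" and ?K = "orbit_ball z (2 * r)"
  let ?fib = "\<lambda>k. {g \<in> ?B. inv g \<otimes> k \<in> ?B}"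
  let ?t = "\<lambda>j::nat. R - c + real j * \<Delta>"
  let ?d = "\<lambda>k. dist z (\<phi> k z)"
  have mono: "N s \<le> N s'" if "s \<le> s'" for s s'
    using card_orbit_ball_mono[OF that] by (simp add: N_def)
  have fib: "real (card (?fib k)) \<le> N R
      + (\<Sum>j<n. if ?d k < 2 * r - 2 * ?t j then N (R + real (Suc j) * \<Delta>) else 0)"
    if k: "k \<in> ?K" for k
  proof -
    let ?f = "\<lambda>j. if ?d k < 2 * r - 2 * ?t j then N (R + real (Suc j) * \<Delta>) else 0"
    have f0: "?f j \<ge> 0" for j by (simp add: N_def)
    have le: "real (card (?fib k)) \<le> N (r - ?d k / 2 + c)"
      using card_factorizations_le[of k z r] k by (simp add: N_def c_def orbit_ball_def)
    show ?thesis
    proof (cases "r - ?d k / 2 \<le> R - c")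
      case True
      then have "N (r - ?d k / 2 + c) \<le> N R" by (intro mono) simp
      then show ?thesis using le sum_nonneg[of "{..<n}" ?f] f0 by force
    next
      case False
      \<comment> \<open>The first change of \<open>P\<close> finds the bin \<open>j\<close> with
        \<open>r - ?d k / 2\<close> between \<open>?t j\<close> and \<open>?t (Suc j)\<close>. The
        upper end bounds the fibre over \<open>k\<close>; the lower end bounds \<open>?d k\<close>,
        hence the number of such \<open>k\<close>.\<close>
      define P where "P = (\<lambda>i. r - ?d k / 2 \<le> ?t i)"
      have "P n" using r zero_le_dist[of z "\<phi> k z"] unfolding P_def by linarith
      moreover have "\<not> P 0" using False by (simp add: P_def)
      ultimately obtain j where j: "j < n" "\<not> P j" "P (Suc j)"
        using ex_least_nat_less[of P n] by auto
      have "N (r - ?d k / 2 + c) \<le> N (R + real (Suc j) * \<Delta>)"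
        using j(3) by (intro mono) (simp add: P_def)
      also have "\<dots> = ?f j" using j(2) by (simp add: P_def)
      also have "\<dots> \<le> sum ?f {..<n}" using j(1) f0 by (intro member_le_sum) auto
      finally show ?thesis using le by (simp add: N_def)
    qed
  qed
  have "N r ^ 2 = real (card (?B \<times> ?B))"
    by (simp add: N_def card_cartesian_product power2_eq_square)
  also have "card (?B \<times> ?B) = (\<Sum>k\<in>?K. card {p \<in> ?B \<times> ?B. fst p \<otimes> snd p = k})"
  proof -
    have "(\<lambda>p. fst p \<otimes> snd p) ` (?B \<times> ?B) \<subseteq> ?K"
      using mult_in_orbit_ball[of _ z r _ r] by auto
    then have "(\<Sum>k\<in>?K. \<Sum>p | p \<in> ?B \<times> ?B \<and> fst p \<otimes> snd p = k. 1) = (\<Sum>p\<in>?B \<times> ?B. 1::nat)"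
      using finite_orbit_ball by (intro sum.group) auto
    then show ?thesis by simp
  qed
  also have "\<dots> \<le> (\<Sum>k\<in>?K. card (?fib k))"
  proof (rule sum_mono)
    fix k assume k: "k \<in> ?K"
    show "card {p \<in> ?B \<times> ?B. fst p \<otimes> snd p = k} \<le> card (?fib k)"
    proof (rule card_inj_on_le[of fst])
      have eq: "h = inv g \<otimes> k" if "g \<in> ?B" "h \<in> ?B" "g \<otimes> h = k" for g h
        using that orbit_ball_closed by (metis inv_solve_left m_closed subsetD)
      show "inj_on fst {p \<in> ?B \<times> ?B. fst p \<otimes> snd p = k}"
      proof (intro inj_onI prod_eqI)
        fix p p' assume p: "p \<in> {p \<in> ?B \<times> ?B. fst p \<otimes> snd p = k}"
          "p' \<in> {p \<in> ?B \<times> ?B. fst p \<otimes> snd p = k}" "fst p = fst p'"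
        have "snd p = inv (fst p) \<otimes> k" "snd p' = inv (fst p') \<otimes> k"
          using p by (intro eq; force)+
        then show "snd p = snd p'" using p(3) by simp
      qed
      show "fst ` {p \<in> ?B \<times> ?B. fst p \<otimes> snd p = k} \<subseteq> ?fib k"
        using eq by auto
      show "finite (?fib k)" using finite_orbit_ball by simp
    qed
  qed
  finally have "N r ^ 2 \<le> (\<Sum>k\<in>?K. real (card (?fib k)))" by simp
  also have "\<dots> \<le> (\<Sum>k\<in>?K. N R
      + (\<Sum>j<n. if ?d k < 2 * r - 2 * ?t j then N (R + real (Suc j) * \<Delta>) else 0))"
    by (intro sum_mono fib)
  also have "\<dots> = N (2 * r) * N R
      + (\<Sum>j<n. \<Sum>k\<in>?K. if ?d k < 2 * r - 2 * ?t j then N (R + real (Suc j) * \<Delta>) else 0)"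
    by (subst sum.distrib, subst sum.swap) (simp add: N_def)
  also have "\<dots> \<le> N (2 * r) * N R + (\<Sum>j<n. N (2 * r - 2 * ?t j) * N (R + real (Suc j) * \<Delta>))"
  proof (intro add_left_mono sum_mono)
    fix j
    have "(\<Sum>k\<in>?K. if ?d k < 2 * r - 2 * ?t j then N (R + real (Suc j) * \<Delta>) else 0)
        = real (card {k \<in> ?K. ?d k < 2 * r - 2 * ?t j}) * N (R + real (Suc j) * \<Delta>)"
      using finite_orbit_ball by (simp add: sum.If_cases Int_def)
    also have "\<dots> \<le> N (2 * r - 2 * ?t j) * N (R + real (Suc j) * \<Delta>)"
      unfolding N_def
      by (intro mult_right_mono of_nat_mono card_mono finite_orbit_ball) (auto simp: orbit_ball_def)
    finally show "(\<Sum>k\<in>?K. if ?d k < 2 * r - 2 * ?t j then N (R + real (Suc j) * \<Delta>) else 0)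
        \<le> N (2 * r - 2 * ?t j) * N (R + real (Suc j) * \<Delta>)" .
  qed
  finally show ?thesis .
qed

text \<open>The choice of \<open>h\<close> gives \<open>exp (h * R) = 9 * exp (H * R)\<close>.
  Evaluating the exponential bound at \<open>2 * R\<close> produces \<open>3 * 9\<^sup>2\<close>,
  the constant \<open>3 ^ 5\<close>. The lower bound on \<open>R\<close> leaves \<open>5 / 6\<close>
  of \<open>R\<close> after removing \<open>2 * (D + 2 * \<delta>)\<close>, and
  \<open>9 ^ 5 \<ge> 6 ^ 6\<close> yields the required factor 6.\<close>

lemma orbit_ball_doubling:
  assumes ent: "entropy_at G \<phi> z \<le> ereal H" and H: "H > 0"
    and R: "R \<ge> 12 * (D + 2 * \<delta>)"
  shows "real (card (orbit_ball z (2 * R))) \<le> 3 ^ 5 * exp (2 * H * R) * real (card (orbit_ball z R))"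
proof -
  define h where "h = H + ln 9 / R"
  define \<Delta> where "\<Delta> = ln 2 / h"
  have R0: "R > 0" using R D_pos \<delta>_pos by simp
  have hR: "h * R = H * R + ln 9" using R0 by (simp add: h_def field_simps)
  have h: "h > H" "h > 0" using R0 H by (simp_all add: h_def add_pos_pos)
  obtain C where C: "\<And>r. real (card (orbit_ball z r)) \<le> C * exp (h * r)"
    using orbit_ball_exponential_growth[OF ent H h(1)] by blast
  have "exp (h * (R - 2 * (D + 2 * \<delta>))) \<ge> 6"
  proof -
    have "ln 9 * (5 / 6) \<le> h * R * (5 / 6)" using hR H R0 by simp
    also have "\<dots> = h * (R * (5 / 6))" by simp
    also have "\<dots> \<le> h * (R - 2 * (D + 2 * \<delta>))" using R h(2) by (intro mult_left_mono) auto
    finally have "ln 9 * (5 / 6) \<le> h * (R - 2 * (D + 2 * \<delta>))" .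
    moreover have "ln (6::real) \<le> ln 9 * (5 / 6)"
    proof -
      have "ln ((6::real) ^ 6) \<le> ln (9 ^ 5)" by (subst ln_le_cancel_iff) auto
      then have "6 * ln (6::real) \<le> 5 * ln 9" by (simp only: ln_realpow)
      then show ?thesis by simp
    qed
    ultimately have "ln 6 \<le> h * (R - 2 * (D + 2 * \<delta>))" by linarith
    then show ?thesis by (metis exp_le_cancel_iff exp_ln zero_less_numeral)
  qed
  moreover have "exp (h * \<Delta>) = 2" using h by (simp add: \<Delta>_def)
  moreover have "0 < real (card (orbit_ball z 1))"
    using one_in_orbit_ball[of 1 z] finite_orbit_ball[of z 1] by (auto simp: card_gt_0_iff)
  ultimately have "real (card (orbit_ball z (2 * R)))
      \<le> 3 * real (card (orbit_ball z R)) * exp (h * (2 * R))"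
    using exponential_bound_from_splitting[of h \<Delta> R "D + 2 * \<delta>" "\<lambda>r. real (card (orbit_ball z r))" C "2 * R"]
      h(2) C card_orbit_ball_splitting[of _ R _ \<Delta> z] by simp
  also have "h * (2 * R) = 2 * H * R + 2 * ln 9" using hR by simp
  also have "exp \<dots> = 3 ^ 4 * exp (2 * H * R)"
    by (simp add: exp_add exp_double)
  finally show ?thesis by (simp add: mult_ac)
qed

end

section \<open>The lower bound\<close>

lemma BGT_function_covering:
  fixes G :: "'g monoid"
  assumes "BGT_function \<nu> TYPE('g)" and "K \<ge> 1" and "group G"
    and "A \<subseteq> carrier G" "finite A" "A \<noteq> {}"
    and "real (card (A <#>\<^bsub>G\<^esub> A)) \<le> K * sqrt (real (card A)) * sqrt (real (card A))"
  shows "\<exists>G0 L T. subgroup G0 G \<and> finite L \<and> L \<lhd> (G\<lparr>carrier := G0\<rparr>) \<and>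
    finite T \<and> T \<subseteq> carrier G \<and> card T \<le> \<nu> K \<and> A \<subseteq> (\<Union>t\<in>T. t <#\<^bsub>G\<^esub> G0) \<and>
    nilpotent_group ((G\<lparr>carrier := G0\<rparr>) Mod L)"
proof -
  have "BGT_property \<nu> TYPE('g)" using assms(1) unfolding BGT_function_def by blast
  from this[unfolded BGT_property_def, rule_format, OF assms(2)] show ?thesis
    by - (elim exE conjE, drule_tac x = G in spec, drule_tac x = A in spec, drule_tac x = A in spec,
        (drule mp, rule assms)+, blast)
qed

context cocompact_hyperbolic_action
begin

lemma virtually_cyclic_if_small_translation_length:
  assumes H: "H > 0" and ent: "\<forall>x. entropy_at G \<phi> x \<le> ereal H"
    and BGT: "BGT_function \<nu> TYPE('g)"
    and \<gamma>: "\<gamma> \<in> carrier G" and inf: "\<forall>n::nat. n > 0 \<longrightarrow> \<gamma> [^] n \<noteq> \<one>"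
    and small: "translation_length \<gamma>
      \<le> 2 * (5 * D + \<delta>) / (real (\<nu> (3 ^ 5 * exp (73 * H * (D + 4 * \<delta>)))) + 2)"
  shows "virtually_cyclic G"
proof -
  let ?l = "translation_length \<gamma>"
  define K where "K = 3 ^ 5 * exp (73 * H * (D + 4 * \<delta>))"
  \<comment> \<open>Twice this radius is \<open>72 * (D + 4 * \<delta>)\<close>, within the 73 of
    \<open>K\<close>.\<close>
  define R where "R = 36 * (D + 4 * \<delta>)"
  have pos: "0 < ?l" by (rule translation_length_pos[OF \<gamma> inf])
  obtain z where z: "\<And>k. disp \<gamma> k z \<le> real k * ?l + 6 * D + 22 * \<delta>"
    using almost_axis[OF \<gamma> pos] by blast
  define A where "A = orbit_ball z R"
  have R0: "R > 0" using D_pos \<delta>_pos by (simp add: R_def)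
  have finA: "finite A" unfolding A_def by (rule finite_orbit_ball)
  have A_closed: "A \<subseteq> carrier G" unfolding A_def by (rule orbit_ball_closed)
  have A_ne: "A \<noteq> {}" using one_in_orbit_ball[OF R0] by (auto simp: A_def)
  have K1: "K \<ge> 1"
  proof -
    have "1 * 1 \<le> (3::real) ^ 5 * exp (73 * H * (D + 4 * \<delta>))"
      using H D_pos \<delta>_pos by (intro mult_mono) auto
    then show ?thesis by (simp add: K_def)
  qed
  have "card (A <#> A) \<le> card (orbit_ball z (2 * R))"
    using mult_in_orbit_ball[of _ z R _ R]
    by (intro card_mono finite_orbit_ball) (auto simp: A_def set_mult_def)
  then have "real (card (A <#> A)) \<le> real (card (orbit_ball z (2 * R)))" by simp
  also have "\<dots> \<le> 3 ^ 5 * exp (2 * H * R) * real (card A)"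
    unfolding A_def using ent H D_pos \<delta>_pos by (intro orbit_ball_doubling) (auto simp: R_def)
  also have "\<dots> \<le> K * real (card A)"
    unfolding K_def using H D_pos \<delta>_pos by (intro mult_right_mono) (auto simp: R_def)
  also have "\<dots> = K * sqrt (real (card A)) * sqrt (real (card A))" by simp
  finally have small_doubling:
    "real (card (A <#> A)) \<le> K * sqrt (real (card A)) * sqrt (real (card A))" .
  obtain G0 L T where G0: "subgroup G0 G" and L: "finite L" "L \<lhd> (G\<lparr>carrier := G0\<rparr>)"
    and T: "finite T" "T \<subseteq> carrier G" "card T \<le> \<nu> K" "A \<subseteq> (\<Union>t\<in>T. t <# G0)"
    and nil: "nilpotent_group ((G\<lparr>carrier := G0\<rparr>) Mod L)"
    using BGT_function_covering[OF BGT K1 is_group A_closed finA A_ne small_doubling] by blast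
  interpret G0: subgroup G0 G by (rule G0)
  interpret K0: group "G\<lparr>carrier := G0\<rparr>" using G0.subgroup_is_group is_group .
  \<comment> \<open>The powers have displacement at most
    \<open>(10 * D + 2 * \<delta>) + (6 * D + 22 * \<delta>)\<close>, from \<open>small\<close> and
    the almost axis. The ball containing \<sigma> generates the group, by chains with step length
    \<delta>.\<close>
  have pow_in_A: "\<gamma> [^] k \<otimes> \<sigma> \<in> A"
    if k: "k \<le> \<nu> K" and \<sigma>: "\<sigma> \<in> orbit_ball z (\<delta> + 2 * (D + \<delta>))" for k \<sigma>
  proof -
    have "real k * ?l \<le> real (\<nu> K) * (2 * (5 * D + \<delta>) / (real (\<nu> K) + 2))"
      using k small pos by (intro mult_mono) (auto simp: K_def)
    also have "\<dots> \<le> 2 * (5 * D + \<delta>)"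
      using D_pos \<delta>_pos by (simp add: field_simps)
    finally have "disp \<gamma> k z \<le> 16 * D + 24 * \<delta>" using z[of k] by simp
    then have "\<gamma> [^] k \<in> orbit_ball z (16 * D + 25 * \<delta>)"
      using \<gamma> \<delta>_pos by (simp add: orbit_ball_def disp_def)
    from mult_in_orbit_ball[OF this \<sigma>] show ?thesis
      using orbit_ball_mono[of "16 * D + 25 * \<delta> + (\<delta> + 2 * (D + \<delta>))" R z] D_pos \<delta>_pos
      unfolding A_def R_def by auto
  qed
  have conj_in_G0: "\<exists>j::nat. j > 0 \<and> inv \<sigma> \<otimes> \<gamma> [^] j \<otimes> \<sigma> \<in> G0"
    if \<sigma>: "\<sigma> \<in> orbit_ball z (\<delta> + 2 * (D + \<delta>))" for \<sigma>
  proof -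
    have \<sigma>c: "\<sigma> \<in> carrier G" using \<sigma> orbit_ball_closed by blast
    have "\<forall>k\<in>{..\<nu> K}. \<exists>t\<in>T. \<gamma> [^] k \<otimes> \<sigma> \<in> t <# G0" using pow_in_A[OF _ \<sigma>] T(4) by blast
    then obtain t where t: "\<And>k. k \<le> \<nu> K \<Longrightarrow> t k \<in> T" "\<And>k. k \<le> \<nu> K \<Longrightarrow> \<gamma> [^] k \<otimes> \<sigma> \<in> t k <# G0"
      by (metis atMost_iff)
    \<comment> \<open>The exponents from 0 to \<open>\<nu> K\<close> are one more than the available
      cosets.\<close>
    have "card (t ` {..\<nu> K}) \<le> card T" using t(1) T(1) by (intro card_mono) auto
    then have "card (t ` {..\<nu> K}) < card {..\<nu> K}" using T(3) by simp
    then have "\<not> inj_on t {..\<nu> K}" by (rule pigeonhole)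
    then obtain m n where mn: "m < n" "n \<le> \<nu> K" "t m = t n"
      unfolding inj_on_def by (metis atMost_iff linorder_neqE_nat)
    obtain a where a: "a \<in> G0" "\<gamma> [^] m \<otimes> \<sigma> = t n \<otimes> a"
      using t(2)[of m] mn unfolding l_coset_def by auto
    obtain b where b: "b \<in> G0" "\<gamma> [^] n \<otimes> \<sigma> = t n \<otimes> b"
      using t(2)[of n] mn unfolding l_coset_def by auto
    have tc: "t n \<in> carrier G" using t(1)[OF mn(2)] T(2) by blast
    have "inv \<sigma> \<otimes> \<gamma> [^] (n - m) \<otimes> \<sigma> = inv (\<gamma> [^] m \<otimes> \<sigma>) \<otimes> (\<gamma> [^] n \<otimes> \<sigma>)"
      using nat_pow_diff(1)[OF \<gamma>, of m n] mn \<gamma> \<sigma>c by (simp add: inv_mult_group m_assoc)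
        (simp flip: m_assoc)
    also have "\<dots> = inv a \<otimes> (inv (t n) \<otimes> (t n \<otimes> b))"
      unfolding a(2) b(2) using a(1) b(1) tc by (simp add: inv_mult_group m_assoc)
    also have "\<dots> = inv a \<otimes> b" using a(1) b(1) tc by (simp flip: m_assoc)
    finally have "inv \<sigma> \<otimes> \<gamma> [^] (n - m) \<otimes> \<sigma> \<in> G0" using a(1) b(1) by simp
    then show ?thesis using mn(1) by (intro exI[of _ "n - m"]) simp
  qed
  have "\<one> \<in> orbit_ball z (\<delta> + 2 * (D + \<delta>))" using D_pos \<delta>_pos by (intro one_in_orbit_ball) simp
  from conj_in_G0[OF this] obtain i :: nat where i: "i > 0" "\<gamma> [^] i \<in> G0" using \<gamma> by auto
  have inv_eq: "inv\<^bsub>G\<lparr>carrier := G0\<rparr>\<^esub> x = inv x" if "x \<in> G0" for x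
    using m_inv_consistent[OF G0 that] .
  have G0_sub: "G0 \<subseteq> quasi_normalizer \<gamma>"
  proof -
    \<comment> \<open>The powers of \<open>\<gamma> [^] i\<close> lie in \<open>G0\<close> and so
      permute the finite normal subgroup \<open>L\<close> by conjugation.\<close>
    have L_sub: "L \<subseteq> quasi_normalizer \<gamma>"
    proof
      fix l assume l: "l \<in> L"
      have lG0: "l \<in> G0" using l normal_imp_subgroup[OF L(2)] subgroup.subset by fastforce
      show "l \<in> quasi_normalizer \<gamma>"
      proof (rule finite_orbit_quasi_normalizer[OF \<gamma> i(1) _ L(1)])
        show "l \<in> carrier G" using lG0 by simp
        fix n :: nat
        have x: "\<gamma> [^] (i * n) \<in> G0"
          using K0.nat_pow_closed[of "\<gamma> [^] i" n] i(2) \<gamma> by (simp add: nat_pow_consistent[symmetric] nat_pow_pow)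
        then show "\<gamma> [^] (i * n) \<otimes> l \<otimes> inv (\<gamma> [^] (i * n)) \<in> L"
          using normal.inv_op_closed2[OF L(2), of "\<gamma> [^] (i * n)" l] l by (simp add: inv_eq)
      qed
    qed
    have "carrier (G\<lparr>carrier := G0\<rparr>) \<subseteq> quasi_normalizer \<gamma>"
    proof (rule K0.nilpotent_quotient_descent[OF L(2) nil, of "\<gamma> [^] i"])
      show "\<gamma> [^] i \<in> carrier (G\<lparr>carrier := G0\<rparr>)" using i(2) by simp
      show "L \<subseteq> quasi_normalizer \<gamma>" by (rule L_sub)
      fix c assume c: "c \<in> carrier (G\<lparr>carrier := G0\<rparr>)"
      let ?x = "\<gamma> [^] i"
      assume "?x \<otimes>\<^bsub>G\<lparr>carrier := G0\<rparr>\<^esub> c \<otimes>\<^bsub>G\<lparr>carrier := G0\<rparr>\<^esub> inv\<^bsub>G\<lparr>carrier := G0\<rparr>\<^esub> ?x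
        \<otimes>\<^bsub>G\<lparr>carrier := G0\<rparr>\<^esub> inv\<^bsub>G\<lparr>carrier := G0\<rparr>\<^esub> c \<in> quasi_normalizer \<gamma>"
      then have d: "?x \<otimes> c \<otimes> inv ?x \<otimes> inv c \<in> quasi_normalizer \<gamma>" (is "?d \<in> _")
        using c i(2) by (simp add: inv_eq)
      have cc: "c \<in> carrier G" and xc: "?x \<in> carrier G" using c \<gamma> by simp_all
      \<comment> \<open>A commutator in the quasi-normalizer puts the conjugate of \<open>?x\<close>
        by \<open>c\<close> there too, and then \<open>c\<close> itself.\<close>
      have "inv ?d \<otimes> ?x = c \<otimes> ?x \<otimes> inv c"
        using cc xc by (simp add: inv_mult_group m_assoc)
      then have "c \<otimes> ?x \<otimes> inv c \<in> quasi_normalizer \<gamma>"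
        using quasi_normalizer_mult[OF \<gamma> quasi_normalizer_inv[OF \<gamma> d] quasi_normalizer_pow[OF \<gamma>, of i]]
        by simp
      then show "c \<in> quasi_normalizer \<gamma>"
        by (rule conj_pow_in_quasi_normalizer[OF \<gamma> pos cc i(1)])
    qed
    then show ?thesis by simp
  qed
  have gens: "orbit_ball z (\<delta> + 2 * (D + \<delta>)) \<subseteq> quasi_normalizer \<gamma>"
  proof
    fix \<sigma> assume \<sigma>: "\<sigma> \<in> orbit_ball z (\<delta> + 2 * (D + \<delta>))"
    have \<sigma>c: "\<sigma> \<in> carrier G" using \<sigma> orbit_ball_closed by blast
    obtain j :: nat where j: "j > 0" "inv \<sigma> \<otimes> \<gamma> [^] j \<otimes> \<sigma> \<in> G0" using conj_in_G0[OF \<sigma>] by blast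
    then have "inv \<sigma> \<otimes> \<gamma> [^] j \<otimes> inv (inv \<sigma>) \<in> quasi_normalizer \<gamma>" using G0_sub \<sigma>c by auto
    then have "inv \<sigma> \<in> quasi_normalizer \<gamma>"
      using conj_pow_in_quasi_normalizer[OF \<gamma> pos, of "inv \<sigma>" j] \<sigma>c j(1) by simp
    then show "\<sigma> \<in> quasi_normalizer \<gamma>" using quasi_normalizer_inv[OF \<gamma>, of "inv \<sigma>"] \<sigma>c by simp
  qed
  have "carrier G \<subseteq> quasi_normalizer \<gamma>"
  proof
    fix g assume g: "g \<in> carrier G"
    obtain n :: nat where "real n > dist z (\<phi> g z) / \<delta>" using reals_Archimedean2 by blast
    then have "g \<in> orbit_ball z (real n * \<delta>)" using g \<delta>_pos by (simp add: orbit_ball_def field_simps)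
    then have "g \<in> set_pow (orbit_ball z (\<delta> + 2 * (D + \<delta>))) n"
      using orbit_ball_subset_set_pow by blast
    moreover have "\<one> \<in> quasi_normalizer \<gamma>" using quasi_normalizer_pow[OF \<gamma>, of 0] by simp
    ultimately show "g \<in> quasi_normalizer \<gamma>"
      using set_pow_subset[OF gens] quasi_normalizer_mult[OF \<gamma>] by blast
  qed
  then show ?thesis by (rule virtually_cyclic_if_quasi_normalizer[OF \<gamma> pos])
qed

end

theorem mainTheorem4:
  fixes \<delta> H D :: real
    and G :: "'g monoid"
    and \<phi> :: "'g \<Rightarrow> 'a::metric_space \<Rightarrow> 'a"
    and \<nu> :: "real \<Rightarrow> nat"
  assumes "\<delta> > 0" "H > 0" "D > 0"
    and "hyperbolic \<delta> TYPE('a)"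
    and "group G"
    and "\<not> virtually_cyclic G"
    and "isometric_action G \<phi>"
    and "proper_action G \<phi>"
    and "quotient_diam G \<phi> \<le> ereal D"
    and "\<forall>x. entropy_at G \<phi> x \<le> ereal H"
    and "BGT_function \<nu> TYPE('g)"
    and "\<gamma> \<in> carrier G"
    and "\<forall>n::nat. n > 0 \<longrightarrow> \<gamma> [^]\<^bsub>G\<^esub> n \<noteq> \<one>\<^bsub>G\<^esub>"
  shows "\<forall>x. asymp_displacement G \<phi> \<gamma> x >
           2 * (5 * D + \<delta>) / (real (\<nu> (3 ^ 5 * exp (73 * H * (D + 4 * \<delta>)))) + 2)"
proof -
  interpret cocompact_hyperbolic_action G \<phi> \<delta> D
    using assms by (intro cocompact_hyperbolic_action.intro isometric_group_action.intro
        isometric_group_action_axioms.intro cocompact_hyperbolic_action_axioms.intro)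
  have "\<not> translation_length \<gamma>
      \<le> 2 * (5 * D + \<delta>) / (real (\<nu> (3 ^ 5 * exp (73 * H * (D + 4 * \<delta>)))) + 2)"
    using virtually_cyclic_if_small_translation_length[OF assms(2,10-13)] assms(6) by blast
  then show ?thesis using asymp_displacement_eq[OF assms(12)] by (simp add: not_le)
qed

end
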